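(* For all $a,b\in\mathbb N$, every hereditary class of graphs that excludes $K_{a,a}$ and the $b$-vertex path has bounded $\mathrm{tree}\text{-}\alpha$. That is, for all $a,b\in\mathbb N$, the class of all $K_{a,a}$-free graphs with no induced subgraph isomorphic to the $b$-vertex path has bounded $\mathrm{tree}\text{-}\alpha$.
   Context: $\mathbb N$ is the set of positive integers. Graphs are finite, with no loops or parallel edges. A class of graphs is hereditary if it is closed under taking induced subgraphs. $G$ is $H$-free if no induced subgraph of $G$ is isomorphic to $H$; a class excludes $H$ if all its members are $H$-free. The tree independence number $\mathrm{tree}\text{-}\alpha(G)$ is the minimum $c\in\mathbb N$ such that $G$ admits a tree decomposition each of whose bags induces a subgraph with no stable set (set of pairwise nonadjacent vertices) on $c+1$ vertices. A class $\mathcal G$ has bounded $\mathrm{tree}\text{-}\alpha$ if there is $c\in\mathbb N$ with $\mathrm{tree}\text{-}\alpha(G)\le c$ for all $G\in\mathcal G$. *)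

theory Defs
  imports "Graph_Theory.Graph_Theory"
begin

text \<open>
  A finite graph without loops or parallel edges is a \<open>pair_graph\<close>: a finite vertex set with a
  symmetric irreflexive set of arcs, where the arcs \<open>(u, v)\<close> and \<open>(v, u)\<close> together
  encode one edge. \<^const>\<open>with_proj\<close> embeds such graphs into the library's general digraphs.
\<close>

definition H_free :: "'h pair_pre_digraph \<Rightarrow> 'a pair_pre_digraph \<Rightarrow> bool" where
  "H_free H G \<longleftrightarrow>
    \<not> (\<exists>G' :: 'a pair_pre_digraph. induced_subgraph (with_proj G') (with_proj G) \<and>
      digraph_iso (with_proj G') (with_proj H))"

definition excludes :: "'a pair_pre_digraph set \<Rightarrow> 'h pair_pre_digraph \<Rightarrow> bool" where
  "excludes \<G> H \<longleftrightarrow> (\<forall>G\<in>\<G>. H_free H G)"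

definition graph_class :: "'a pair_pre_digraph set \<Rightarrow> bool" where
  "graph_class \<G> \<longleftrightarrow> (\<forall>G\<in>\<G>. pair_graph G)"

definition hereditary :: "'a pair_pre_digraph set \<Rightarrow> bool" where
  "hereditary \<G> \<longleftrightarrow>
    (\<forall>G\<in>\<G>. \<forall>G' :: 'a pair_pre_digraph.
      induced_subgraph (with_proj G') (with_proj G) \<longrightarrow> G' \<in> \<G>)"

definition complete_bipartite :: "nat \<Rightarrow> nat \<Rightarrow> (nat + nat) pair_pre_digraph" where
  "complete_bipartite m n =
    (let U = Inl ` {..<m}; V = Inr ` {..<n}
     in \<lparr> pverts = U \<union> V, parcs = U \<times> V \<union> V \<times> U \<rparr>)"

definition path_graph :: "nat \<Rightarrow> nat pair_pre_digraph" where
  "path_graph n =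
    \<lparr> pverts = {..<n}, parcs = {(i, j). i < n \<and> j < n \<and> (j = Suc i \<or> i = Suc j)} \<rparr>"

text \<open>
  The library's \<^const>\<open>tree\<close> is unsuitable for symmetric digraphs: its \<^const>\<open>forest\<close>
  forbids every directed cycle, and each edge of a symmetric digraph is a directed cycle of
  length 2. The cycles of an undirected graph are the directed cycles of length at least 3.
\<close>

definition undirected_tree :: "'t pair_pre_digraph \<Rightarrow> bool" where
  "undirected_tree T \<longleftrightarrow>
    pair_graph T \<and> connected (with_proj T) \<and>
    \<not> (\<exists>p. pre_digraph.cycle (with_proj T) p \<and> 3 \<le> length p)"

definition tree_decomposition ::
    "'a pair_pre_digraph \<Rightarrow> 't pair_pre_digraph \<Rightarrow> ('t \<Rightarrow> 'a set) \<Rightarrow> bool" where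
  "tree_decomposition G T \<beta> \<longleftrightarrow>
    undirected_tree T \<and>
    (\<Union>t\<in>pverts T. \<beta> t) = pverts G \<and>
    (\<forall>(u, v)\<in>parcs G. \<exists>t\<in>pverts T. u \<in> \<beta> t \<and> v \<in> \<beta> t) \<and>
    (\<forall>v\<in>pverts G. connected (with_proj T \<restriction> {t\<in>pverts T. v \<in> \<beta> t}))"

definition stable_set :: "('a, 'b) pre_digraph \<Rightarrow> 'a set \<Rightarrow> bool" where
  "stable_set G S \<longleftrightarrow> S \<subseteq> verts G \<and> pairwise (\<lambda>u v. \<not> u \<rightarrow>\<^bsub>G\<^esub> v) S"

text \<open>
  Nodes of decomposition trees are natural numbers; this is no restriction, as every finite tree
  is isomorphic to one with such nodes.
\<close>

definition has_tree_alpha_bound :: "'a pair_pre_digraph \<Rightarrow> nat \<Rightarrow> bool" where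
  "has_tree_alpha_bound G c \<longleftrightarrow>
    (\<exists>(T :: nat pair_pre_digraph) \<beta>. tree_decomposition G T \<beta> \<and>
      (\<forall>t\<in>pverts T. \<not> (\<exists>S. stable_set (with_proj G \<restriction> \<beta> t) S \<and> card S = c + 1)))"

definition tree_alpha :: "'a pair_pre_digraph \<Rightarrow> nat" where
  "tree_alpha G = (LEAST c. c \<ge> 1 \<and> has_tree_alpha_bound G c)"

definition bounded_tree_alpha :: "'a pair_pre_digraph set \<Rightarrow> bool" where
  "bounded_tree_alpha \<G> \<longleftrightarrow> (\<exists>c\<ge>1. \<forall>G\<in>\<G>. tree_alpha G \<le> c)"


lemma complete_bipartite_digraph_complete_bipartite:
  "complete_bipartite_digraph m n (with_proj (complete_bipartite m n))"
proof -
  have "card (Inl ` {..<m} :: (nat + nat) set) = m" "card (Inr ` {..<n} :: (nat + nat) set) = n"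
    by (simp_all add: card_image)
  then show ?thesis
    unfolding complete_bipartite_digraph_pair_def complete_bipartite_def Let_def
    by (intro conjI exI[of _ "Inl ` {..<m}"] exI[of _ "Inr ` {..<n}"]) auto
qed

lemma pair_graph_path_graph: "pair_graph (path_graph n)"
proof -
  have "finite (parcs (path_graph n))"
    by (rule finite_subset[of _ "{..<n} \<times> {..<n}"]) (auto simp: path_graph_def)
  then show ?thesis
    by unfold_locales (auto simp: path_graph_def symmetric_def intro!: symI)
qed

text \<open>The minimum defining \<^const>\<open>tree_alpha\<close> is attained, by the one-bag decomposition.\<close>

lemma tree_alpha_attained:
  assumes "pair_graph G"
  shows "tree_alpha G \<ge> 1 \<and> has_tree_alpha_bound G (tree_alpha G)"
proof -
  interpret pair_graph G by fact
  define T :: "nat pair_pre_digraph" where "T = \<lparr> pverts = {0}, parcs = {} \<rparr>"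
  have T: "pair_graph T"
    by unfold_locales (auto simp: T_def symmetric_def intro!: symI)
  have conn: "connected (with_proj T \<restriction> {0})" "connected (with_proj T)"
    by (auto simp: connected_def strongly_connected_def mk_symmetric_def T_def reachable_def)
  have "\<not> pre_digraph.cycle (with_proj T) p" for p
    by (auto simp: pre_digraph.cycle_def pre_digraph.awalk_def T_def)
  with T conn have "undirected_tree T"
    by (auto simp: undirected_tree_def)
  moreover have "{t \<in> pverts T. v \<in> pverts G} = {0}" if "v \<in> pverts G" for v
    using that by (auto simp: T_def)
  ultimately have "tree_decomposition G T (\<lambda>_. pverts G)"
    using conn by (auto simp: tree_decomposition_def T_def wellformed')
  moreover have "card S \<noteq> card (pverts G) + 1 + 1" if "stable_set (with_proj G \<restriction> pverts G) S" for S
    using that card_mono[OF pair_finite_verts, of S] by (auto simp: stable_set_def)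
  ultimately have "has_tree_alpha_bound G (card (pverts G) + 1)"
    unfolding has_tree_alpha_bound_def by blast
  then show ?thesis
    unfolding tree_alpha_def
    using LeastI[of "\<lambda>c. c \<ge> 1 \<and> has_tree_alpha_bound G c" "card (pverts G) + 1"] by simp
qed

end

theory Submission
  imports Defs "HOL-Library.FuncSet"
begin

text \<open>
  Write \<open>\<alpha>(X)\<close> for the largest size of a stable subset of \<open>X\<close>. Call two vertices \<^emph>\<open>linked\<close> if no set with
  small \<open>\<alpha>\<close> separates them. As induced paths have fewer than \<open>b\<close> vertices, the minimax theorem
  gives, for linked \<open>u, v\<close>, a random induced \<open>u\<close>-\<open>v\<close> path whose interior rarely hits any given set with
  small \<open>\<alpha>\<close>. Averaging over a large stable set then shows, by \<open>K\<^bsub>a,a\<^esub>\<close>-freeness, that the vertices whose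
  closed neighbourhood is often hit form a set with small \<open>\<alpha>\<close>. Hence a large stable set of pairwise
  linked vertices would allow one to concatenate random paths into a long induced path.

  If some stable set \<open>S\<close> had no balanced separator with small \<open>\<alpha>\<close>, every set \<open>X\<close> with small \<open>\<alpha>\<close> would leave
  one connected set carrying most of \<open>S\<close>. The vertices not separated from it by any such \<open>X\<close> are
  pairwise linked, so they can be deleted; every other vertex has a separator, and a path in the style of
  Gyarfas, which applies the separator of its current end at every step, becomes too long.
  Balanced separators for stable sets yield the tree decomposition by the usual recursion, which works
  for \<open>\<alpha>\<close> because \<open>\<alpha>\<close> is additive over components.
\<close>

section \<open>A minimax theorem\<close>

text \<open>Chooses the weight of the eliminated coordinate in \<open>cone_alternative\<close>: any
  number slightly above the larger of 0 and all lower bounds serves.\<close>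

lemma exists_nonneg_between:
  fixes l u :: "'b \<Rightarrow> real"
  assumes "finite A" "finite B"
    and "\<And>i j. i \<in> A \<Longrightarrow> j \<in> B \<Longrightarrow> l i < u j" and "\<And>j. j \<in> B \<Longrightarrow> 0 < u j"
  shows "\<exists>t\<ge>0. (\<forall>i\<in>A. l i < t) \<and> (\<forall>j\<in>B. t < u j)"
proof -
  define x where "x = Max (insert 0 (l ` A))"
  have x: "0 \<le> x" "\<forall>i\<in>A. l i \<le> x"
    using assms(1) by (auto simp: x_def)
  have "x \<in> insert 0 (l ` A)"
    unfolding x_def using assms(1) by (intro Max_in) auto
  then have xu: "\<forall>j\<in>B. x < u j"
    using assms by auto
  show ?thesis
  proof (cases "B = {}")
    case True
    then show ?thesis using x by (intro exI[of _ "x + 1"]) fastforce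
  next
    case False
    then have "x < Min (u ` B)"
      using assms(2) xu by simp
    then obtain t where "x < t" "t < Min (u ` B)"
      using dense by blast
    with x assms(2) False show ?thesis
      by (intro exI[of _ t]) (auto simp: Min_gr_iff)
  qed
qed

text \<open>Fourier-Motzkin elimination of the coordinates in \<open>J\<close> one by one. Carrying
  an abstract cone \<open>C\<close> around the finite set \<open>X\<close> lets the induction pass
  to the part of \<open>C\<close> with \<open>x k \<le> 0\<close>, where a positive coordinate must
  occur in the remaining \<open>J\<close>.\<close>

lemma cone_alternative:
  fixes X C :: "('j \<Rightarrow> real) set"
  assumes "finite J" "finite X" "X \<subseteq> C"
    and "\<And>x y. x \<in> C \<Longrightarrow> y \<in> C \<Longrightarrow> (\<lambda>j. x j + y j) \<in> C"
    and "\<And>c x. 0 < c \<Longrightarrow> x \<in> C \<Longrightarrow> (\<lambda>j. c * x j) \<in> C"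
    and "\<And>x. x \<in> C \<Longrightarrow> \<exists>j\<in>J. 0 < x j"
  shows "\<exists>q. (\<forall>j\<in>J. 0 \<le> q j) \<and> (\<forall>x\<in>X. 0 < (\<Sum>j\<in>J. q j * x j))"
  using assms
proof (induction J arbitrary: X C rule: finite_induct)
  case empty
  then show ?case by blast
next
  case (insert k J)
  define N where "N = {x \<in> X. x k \<le> 0}"
  define P where "P = {x \<in> X. 0 < x k}"
  \<comment> \<open>For \<open>x k < 0 < y k\<close> this is the positive combination of
    \<open>x\<close> and \<open>y\<close> in which coordinate \<open>k\<close> cancels.\<close>
  define mix where "mix x y = (\<lambda>j. y k * x j + (- x k) * y j)" for x y :: "'j \<Rightarrow> real"
  define X' where "X' = N \<union> (\<lambda>(x, y). mix x y) ` ({x \<in> N. x k < 0} \<times> P)"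
  define C' where "C' = {x \<in> C. x k \<le> 0}"
  have fin: "finite N" "finite P"
    using insert.prems by (auto simp: N_def P_def)
  have "\<exists>q. (\<forall>j\<in>J. 0 \<le> q j) \<and> (\<forall>x\<in>X'. 0 < (\<Sum>j\<in>J. q j * x j))"
  proof (rule insert.IH)
    show "finite X'" using fin by (auto simp: X'_def)
    have "mix x y \<in> C'" if "x \<in> N" "x k < 0" "y \<in> P" for x y
    proof -
      have "x \<in> C" "y \<in> C" "0 < y k" using that insert.prems by (auto simp: N_def P_def)
      then have "mix x y \<in> C"
        unfolding mix_def using that by (intro insert.prems(3) insert.prems(4)) auto
      then show ?thesis by (auto simp: C'_def mix_def)
    qed
    then show "X' \<subseteq> C'"
      using insert.prems(2) by (auto simp: X'_def C'_def N_def)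
  next
    fix x y assume "x \<in> C'" "y \<in> C'"
    then show "(\<lambda>j. x j + y j) \<in> C'"
      using insert.prems(3) by (auto simp: C'_def)
  next
    fix c :: real and x assume "0 < c" "x \<in> C'"
    then show "(\<lambda>j. c * x j) \<in> C'"
      using insert.prems(4) by (auto simp: C'_def mult_nonneg_nonpos)
  next
    fix x assume "x \<in> C'"
    then show "\<exists>j\<in>J. 0 < x j"
      using insert.prems(5)[of x] by (auto simp: C'_def)
  qed
  then obtain q where q: "\<And>j. j \<in> J \<Longrightarrow> 0 \<le> q j" "\<And>x. x \<in> X' \<Longrightarrow> 0 < (\<Sum>j\<in>J. q j * x j)"
    by blast
  define d where "d x = (\<Sum>j\<in>J. q j * x j)" for x
  have d_mix: "d (mix x y) = y k * d x - x k * d y" for x y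
    by (simp add: d_def mix_def algebra_simps sum.distrib sum_subtractf sum_distrib_left)
  \<comment> \<open>Vectors in \<open>P\<close> bound the weight \<open>t\<close> of coordinate
    \<open>k\<close> from below, those with \<open>x k < 0\<close> from above. The bounds are
    compatible because \<open>q\<close> is positive on each \<open>mix x y\<close>.\<close>
  have "\<exists>t\<ge>0. (\<forall>y\<in>P. - d y / y k < t) \<and> (\<forall>x\<in>{x \<in> N. x k < 0}. t < d x / (- x k))"
  proof (rule exists_nonneg_between)
    fix y x assume yx: "y \<in> P" "x \<in> {x \<in> N. x k < 0}"
    then have "mix x y \<in> X'" by (auto simp: X'_def)
    then have "0 < y k * d x - x k * d y" using q(2)[of "mix x y"] d_mix[of x y] unfolding d_def by metis
    moreover have "0 < y k" "x k < 0" using yx by (auto simp: P_def)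
    ultimately show "- d y / y k < d x / (- x k)"
      by (simp add: field_simps)
  next
    fix x assume "x \<in> {x \<in> N. x k < 0}"
    then show "0 < d x / (- x k)"
      using q(2)[of x] by (auto simp: X'_def d_def divide_pos_neg)
  qed (use fin in auto)
  then obtain t where t: "0 \<le> t" "\<And>y. y \<in> P \<Longrightarrow> - d y / y k < t"
      "\<And>x. x \<in> N \<Longrightarrow> x k < 0 \<Longrightarrow> t < d x / (- x k)"
    by blast
  define q' where "q' = q(k := t)"
  have eq: "(\<Sum>j\<in>insert k J. q' j * x j) = t * x k + d x" for x
  proof -
    have "(\<Sum>j\<in>J. q' j * x j) = d x"
      unfolding d_def q'_def using insert.hyps by (intro sum.cong) auto
    then show ?thesis using insert.hyps by (simp add: q'_def)
  qed
  have "0 < t * x k + d x" if "x \<in> X" for x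
  proof (cases "0 < x k")
    case True
    then have "- d x / x k < t" using that t(2) by (auto simp: P_def)
    then show ?thesis using True by (simp add: field_simps)
  next
    case False
    then have N: "x \<in> N" using that by (auto simp: N_def)
    show ?thesis
    proof (cases "x k = 0")
      case True
      then show ?thesis using q(2)[of x] N by (auto simp: X'_def d_def)
    next
      case nz: False
      then have "x k < 0" using False by auto
      then show ?thesis using t(3)[OF N] by (simp add: field_simps)
    qed
  qed
  then have "\<forall>x\<in>X. 0 < (\<Sum>j\<in>insert k J. q' j * x j)"
    unfolding eq by blast
  moreover have "\<forall>j\<in>insert k J. 0 \<le> q' j"
    using q(1) t(1) by (simp add: q'_def)
  ultimately show ?case by blast
qed

text \<open>Ville's form of the minimax theorem for the finite zero-sum game with payoff matrix \<open>M\<close>.\<close>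

lemma ville_alternative:
  fixes M :: "'i \<Rightarrow> 'j \<Rightarrow> real"
  assumes "finite I" "finite J"
  shows "(\<exists>p. (\<forall>i\<in>I. 0 \<le> p i) \<and> sum p I = 1 \<and> (\<forall>j\<in>J. (\<Sum>i\<in>I. p i * M i j) \<le> 0)) \<or>
    (\<exists>q. (\<forall>j\<in>J. 0 \<le> q j) \<and> (\<forall>i\<in>I. 0 < (\<Sum>j\<in>J. q j * M i j)))"
proof (rule disjCI)
  assume no: "\<not> (\<exists>q. (\<forall>j\<in>J. 0 \<le> q j) \<and> (\<forall>i\<in>I. 0 < (\<Sum>j\<in>J. q j * M i j)))"
  define comb where "comb p = (\<lambda>j. \<Sum>i\<in>I. p i * M i j)" for p
  \<comment> \<open>Nontrivial nonnegative combinations of the rows of \<open>M\<close>. Only a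
    positive total weight is asked, so that \<open>C\<close> is a cone; normalising at the end gives
    a probability vector.\<close>
  define C where "C = comb ` {p. (\<forall>i\<in>I. 0 \<le> p i) \<and> 0 < sum p I}"
  have "\<exists>x\<in>C. \<forall>j\<in>J. x j \<le> 0"
  proof (rule ccontr)
    assume "\<not> (\<exists>x\<in>C. \<forall>j\<in>J. x j \<le> 0)"
    then have pos: "\<And>x. x \<in> C \<Longrightarrow> \<exists>j\<in>J. 0 < x j" by (meson not_le)
    have "\<exists>q. (\<forall>j\<in>J. 0 \<le> q j) \<and> (\<forall>x\<in>M ` I. 0 < (\<Sum>j\<in>J. q j * x j))"
    proof (rule cone_alternative[OF assms(2) _ _ _ _ pos])
      show "M ` I \<subseteq> C"
      proof
        fix x assume "x \<in> M ` I"
        then obtain i where i: "i \<in> I" "x = M i" by blast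
        have "M i = comb (\<lambda>i'. if i' = i then 1 else 0)"
          using assms(1) i(1) by (auto simp: comb_def fun_eq_iff if_distrib[of "\<lambda>c. c * _"] cong: if_cong)
        then show "x \<in> C"
          using assms(1) i by (auto simp: C_def)
      qed
    next
      fix x y assume "x \<in> C" "y \<in> C"
      then obtain p p' where p: "x = comb p" "\<forall>i\<in>I. 0 \<le> p i" "0 < sum p I"
        and p': "y = comb p'" "\<forall>i\<in>I. 0 \<le> p' i" "0 < sum p' I"
        by (auto simp: C_def)
      have "(\<lambda>j. x j + y j) = comb (\<lambda>i. p i + p' i)"
        by (simp add: p p' comb_def algebra_simps sum.distrib)
      then show "(\<lambda>j. x j + y j) \<in> C"
        unfolding C_def using p p'
        by (intro image_eqI[of _ _ "\<lambda>i. p i + p' i"]) (auto simp: sum.distrib)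
    next
      fix c :: real and x assume c: "0 < c" and "x \<in> C"
      then obtain p where p: "x = comb p" "\<forall>i\<in>I. 0 \<le> p i" "0 < sum p I"
        by (auto simp: C_def)
      have "(\<lambda>j. c * x j) = comb (\<lambda>i. c * p i)"
        by (simp add: p comb_def sum_distrib_left mult.assoc)
      then show "(\<lambda>j. c * x j) \<in> C"
        unfolding C_def using p c
        by (intro image_eqI[of _ _ "\<lambda>i. c * p i"]) (auto simp: sum_distrib_left[symmetric])
    qed (use assms(1) in auto)
    with no show False by auto
  qed
  then obtain p where p: "\<forall>i\<in>I. 0 \<le> p i" "0 < sum p I" "\<forall>j\<in>J. comb p j \<le> 0"
    by (auto simp: C_def)
  define p' where "p' i = p i / sum p I" for i
  have "(\<Sum>i\<in>I. p' i * M i j) = comb p j / sum p I" for j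
    by (simp add: p'_def comb_def sum_divide_distrib)
  moreover have "sum p' I = 1"
    using p by (simp add: p'_def sum_divide_distrib[symmetric])
  ultimately show "\<exists>p. (\<forall>i\<in>I. 0 \<le> p i) \<and> sum p I = 1 \<and> (\<forall>j\<in>J. (\<Sum>i\<in>I. p i * M i j) \<le> 0)"
    using p by (intro exI[of _ p']) (auto simp: p'_def divide_nonpos_pos)
qed

section \<open>Induced paths and connectivity\<close>

locale sgraph =
  fixes V :: "'a set" and E :: "'a \<Rightarrow> 'a \<Rightarrow> bool"
  assumes fin_V: "finite V"
    and adj_sym: "E u v \<Longrightarrow> E v u"
    and adj_irrefl: "\<not> E u u"
    and adj_V: "E u v \<Longrightarrow> u \<in> V \<and> v \<in> V"
begin

definition indep :: "'a set \<Rightarrow> bool" where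
  "indep T \<longleftrightarrow> (\<forall>u\<in>T. \<forall>v\<in>T. \<not> E u v)"

definition alpha_le :: "'a set \<Rightarrow> nat \<Rightarrow> bool" where
  "alpha_le X k \<longleftrightarrow> (\<forall>T\<subseteq>X. indep T \<longrightarrow> card T \<le> k)"

text \<open>A path is the list of its vertices in order. The empty list is excluded, so every path
  has two (possibly equal) ends.\<close>

fun ipath :: "'a list \<Rightarrow> bool" where
  "ipath [] \<longleftrightarrow> False"
| "ipath [v] \<longleftrightarrow> v \<in> V"
| "ipath (u # v # p) \<longleftrightarrow>
     u \<in> V \<and> u \<notin> set (v # p) \<and> E u v \<and> (\<forall>w\<in>set p. \<not> E u w) \<and> ipath (v # p)"

text \<open>Reflexive at every vertex, also outside \<open>C\<close>; membership of the ends in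
  \<open>C\<close> is therefore stated separately where it matters.\<close>

definition reach :: "'a set \<Rightarrow> 'a \<Rightarrow> 'a \<Rightarrow> bool" where
  "reach C = (\<lambda>u v. E u v \<and> u \<in> C \<and> v \<in> C)\<^sup>*\<^sup>*"

definition conn :: "'a set \<Rightarrow> bool" where
  "conn C \<longleftrightarrow> (\<forall>u\<in>C. \<forall>v\<in>C. reach C u v)"

definition closed_nbhd :: "'a \<Rightarrow> 'a set" where
  "closed_nbhd v = {w \<in> V. w = v \<or> E v w}"

section \<open>Stable sets and bounds on their size\<close>

lemma alpha_leD: "alpha_le X k \<Longrightarrow> T \<subseteq> X \<Longrightarrow> indep T \<Longrightarrow> card T \<le> k"
  by (simp add: alpha_le_def)

lemma indep_subset: "indep T \<Longrightarrow> T' \<subseteq> T \<Longrightarrow> indep T'"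
  by (auto simp: indep_def)

lemma alpha_le_subset: "alpha_le X k \<Longrightarrow> Y \<subseteq> X \<Longrightarrow> alpha_le Y k"
  by (auto simp: alpha_le_def)

lemma alpha_le_mono: "alpha_le X k \<Longrightarrow> k \<le> l \<Longrightarrow> alpha_le X l"
  by (meson alpha_le_def le_trans)

lemma alpha_le_empty: "alpha_le {} k"
  by (auto simp: alpha_le_def)

lemma alpha_le_Un:
  assumes "alpha_le X k" "alpha_le Y l"
  shows "alpha_le (X \<union> Y) (k + l)"
  unfolding alpha_le_def
proof (intro allI impI)
  fix T assume T: "T \<subseteq> X \<union> Y" "indep T"
  have "card T = card ((T \<inter> X) \<union> (T - X))" by (simp add: Int_Diff_Un)
  also have "\<dots> \<le> card (T \<inter> X) + card (T - X)" by (rule card_Un_le)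
  also have "\<dots> \<le> k + l"
    using T assms by (intro add_mono alpha_leD[of X] alpha_leD[of Y]) (auto intro: indep_subset)
  finally show "card T \<le> k + l" .
qed

lemma alpha_le_insert: "alpha_le X k \<Longrightarrow> alpha_le (insert v X) (Suc k)"
proof -
  have "card T \<le> 1" if "T \<subseteq> {v}" for T
    using card_mono[OF _ that] by simp
  then have "alpha_le {v} 1"
    by (simp add: alpha_le_def)
  then show "alpha_le X k \<Longrightarrow> ?thesis" using alpha_le_Un[of "{v}" 1 X k] by simp
qed

lemma max_indep_exists:
  assumes "finite W"
  obtains S where "S \<subseteq> W" "indep S" "alpha_le W (card S)"
proof -
  let ?F = "{S. S \<subseteq> W \<and> indep S}"
  have "finite (card ` ?F)" "card ` ?F \<noteq> {}"
    using assms by (auto simp: indep_def)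
  then obtain S where "S \<in> ?F" "card S = Max (card ` ?F)"
    by (metis (mono_tags, lifting) Max_in imageE)
  moreover have "card T \<le> Max (card ` ?F)" if "T \<in> ?F" for T
    using that assms by (intro Max_ge) auto
  ultimately show thesis
    by (intro that[of S]) (auto simp: alpha_le_def)
qed

section \<open>Cutting, gluing and extending induced paths\<close>

lemma ipath_V: "ipath p \<Longrightarrow> set p \<subseteq> V"
  by (induction p rule: ipath.induct) auto

lemma ipath_distinct: "ipath p \<Longrightarrow> distinct p"
  by (induction p rule: ipath.induct) auto

lemma ipath_ne: "ipath p \<Longrightarrow> p \<noteq> []"
  by auto

lemma ipath_Cons: "ipath (u # p) \<Longrightarrow> p \<noteq> [] \<Longrightarrow> ipath p"
  by (cases p) auto

lemma ipath_append1: "ipath (p @ q) \<Longrightarrow> p \<noteq> [] \<Longrightarrow> ipath p"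
proof (induction p rule: ipath.induct)
  case (2 v)
  then show ?case by (cases q) auto
qed auto

lemma ipath_append2: "ipath (p @ q) \<Longrightarrow> q \<noteq> [] \<Longrightarrow> ipath q"
  by (induction p) (auto dest: ipath_Cons)

text \<open>Any two vertices lie together in \<open>q @ [v]\<close>, or together in
  \<open>v # p\<close>, or one lies in \<open>q\<close> and the other in \<open>p\<close>; the third
  premise settles the last kind.\<close>

lemma ipath_glue:
  assumes "ipath (q @ [v])" "ipath (v # p)"
    and "\<And>w x. w \<in> set q \<Longrightarrow> x \<in> set p \<Longrightarrow> w \<noteq> x \<and> \<not> E w x"
  shows "ipath (q @ v # p)"
  using assms
proof (induction q)
  case Nil
  then show ?case by simp
next
  case (Cons u q)
  have "ipath (q @ [v])"
    using Cons.prems(1) ipath_Cons[of u "q @ [v]"] by simp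
  then have IH: "ipath (q @ v # p)"
    using Cons.IH Cons.prems(2,3) by auto
  have "u \<notin> set p \<and> (\<forall>x\<in>set p. \<not> E u x)"
    using Cons.prems(3)[of u] by auto
  then show ?case
    using Cons.prems(1,2) IH by (cases q) auto
qed

lemma ipath_last_edge: "ipath (p @ u # v # q) \<Longrightarrow> E u v"
  using ipath_append2[of p "u # v # q"] by simp

text \<open>Used to see that the first \<open>b\<close> entries of an induced path with at least
  \<open>b\<close> vertices span a copy of the path graph.\<close>

lemma ipath_nth_adj:
  assumes "ipath p" "i < length p" "j < length p"
  shows "E (p ! i) (p ! j) \<longleftrightarrow> j = Suc i \<or> i = Suc j"
  using assms
proof (induction p arbitrary: i j rule: ipath.induct)
  case (2 v)
  then show ?case by (auto simp: adj_irrefl)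
next
  case (3 u v p)
  have first: "E u ((v # p) ! k) \<longleftrightarrow> k = 0" if "k < length (v # p)" for k
    using that 3(2) by (cases k) auto
  have first': "E ((v # p) ! k) u \<longleftrightarrow> k = 0" if "k < length (v # p)" for k
    using first[OF that] adj_sym by blast
  show ?case
  proof (cases i; cases j)
    assume "i = 0" "j = 0"
    then show ?thesis by (simp add: adj_irrefl)
  next
    fix k assume "i = 0" "j = Suc k"
    then show ?thesis using first[of k] 3(4) by simp
  next
    fix k assume "i = Suc k" "j = 0"
    then show ?thesis using first'[of k] 3(3) by simp
  next
    fix k l assume "i = Suc k" "j = Suc l"
    then show ?thesis using 3 by simp
  qed
qed simp

text \<open>Keep only the final piece of \<open>p\<close> that starts at the last vertex equal or
  adjacent to \<open>x\<close>, and put \<open>x\<close> in front unless it is already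
  there.\<close>

lemma ipath_prepend:
  assumes "ipath p" "x \<in> V" "\<exists>y\<in>set p. y = x \<or> E x y"
  shows "\<exists>p'. ipath p' \<and> hd p' = x \<and> last p' = last p \<and> set p' \<subseteq> insert x (set p)"
  using assms
proof (induction p rule: ipath.induct)
  case (2 v)
  then show ?case
  proof (cases "x = v")
    case True
    then show ?thesis using 2 by (intro exI[of _ "[v]"]) auto
  next
    case False
    then show ?thesis using 2 by (intro exI[of _ "[x, v]"]) auto
  qed
next
  case (3 u v p)
  show ?case
  proof (cases "\<exists>y\<in>set (v # p). y = x \<or> E x y")
    case True
    then obtain p' where "ipath p'" "hd p' = x" "last p' = last (v # p)" "set p' \<subseteq> insert x (set (v # p))"
      using 3 by auto
    then show ?thesis by (intro exI[of _ p']) auto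
  next
    case False
    show ?thesis
    proof (cases "x = u")
      case True
      then show ?thesis using 3 by (intro exI[of _ "u # v # p"]) auto
    next
      case xu: False
      then have "E x u" using False 3 by auto
      then show ?thesis using False xu 3
        by (intro exI[of _ "x # u # v # p"]) auto
    qed
  qed
qed simp

section \<open>Reachability and connected sets\<close>

lemma reach_sym: "reach C u v \<Longrightarrow> reach C v u"
  unfolding reach_def
proof (induction rule: rtranclp_induct)
  case (step y z)
  then have "E z y \<and> z \<in> C \<and> y \<in> C" using adj_sym by blast
  with step.IH show ?case by (intro converse_rtranclp_into_rtranclp[where a = z and b = y]) auto
qed simp

lemma reach_trans: "reach C u v \<Longrightarrow> reach C v w \<Longrightarrow> reach C u w"
  by (simp add: reach_def)

lemma reach_refl: "reach C u u"
  by (simp add: reach_def)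

lemma reach_mono: "reach C u v \<Longrightarrow> C \<subseteq> D \<Longrightarrow> reach D u v"
  unfolding reach_def by (erule rtranclp_mono[THEN predicate2D, rotated]) auto

lemma reach_edge: "E u v \<Longrightarrow> u \<in> C \<Longrightarrow> v \<in> C \<Longrightarrow> reach C u v"
  by (auto simp: reach_def)

text \<open>The path is built from the far end of the walk; each earlier vertex is added by
  \<open>ipath_prepend\<close>, which cuts off detours.\<close>

lemma reach_ipath:
  assumes "reach C x y" "x \<in> C" "C \<subseteq> V"
  shows "\<exists>p. ipath p \<and> hd p = x \<and> last p = y \<and> set p \<subseteq> C"
  using assms(1,2) unfolding reach_def
proof (induction rule: converse_rtranclp_induct)
  case base
  then show ?case using assms by (intro exI[of _ "[y]"]) auto
next
  case (step x z)
  then obtain p where p: "ipath p" "hd p = z" "last p = y" "set p \<subseteq> C" by auto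
  have "z \<in> set p" "E x z" "x \<in> C"
    using step(1) ipath_ne[OF p(1)] hd_in_set p(2) by auto
  then obtain p' where "ipath p'" "hd p' = x" "last p' = last p" "set p' \<subseteq> insert x (set p)"
    using ipath_prepend[OF p(1), of x] assms(3) by blast
  then show ?case
    using p \<open>x \<in> C\<close> by (intro exI[of _ p']) auto
qed

lemma conn_Un_family:
  assumes "\<And>C. C \<in> F \<Longrightarrow> conn C" and "\<And>C D. C \<in> F \<Longrightarrow> D \<in> F \<Longrightarrow> C \<inter> D \<noteq> {}"
  shows "conn (\<Union>F)"
  unfolding conn_def
proof (intro ballI)
  fix u v assume "u \<in> \<Union>F" "v \<in> \<Union>F"
  then obtain C D where CD: "C \<in> F" "D \<in> F" "u \<in> C" "v \<in> D" by blast
  then obtain w where "w \<in> C" "w \<in> D" using assms(2) by blast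
  then have "reach C u w" "reach D w v" using assms(1) CD by (auto simp: conn_def)
  then show "reach (\<Union>F) u v"
    using CD by (meson Union_upper reach_mono reach_trans)
qed

lemma conn_insert:
  assumes "conn C" "w \<in> C" "E v w"
  shows "conn (insert v C)"
proof -
  have "reach (insert v C) x w" if "x \<in> insert v C" for x
  proof (cases "x = v")
    case True
    then show ?thesis using assms by (auto intro: reach_edge)
  next
    case False
    then have "reach C x w" using assms that by (simp add: conn_def)
    then show ?thesis by (rule reach_mono) blast
  qed
  then show ?thesis
    unfolding conn_def by (meson reach_sym reach_trans)
qed

end

section \<open>Random induced paths between linked vertices\<close>

text \<open>Union bound for a nonnegative weight.\<close>

lemma sum_UN_le:
  fixes f :: "'b \<Rightarrow> real"
  assumes "finite I" "\<And>i. i \<in> I \<Longrightarrow> finite (A i)" "\<And>x. 0 \<le> f x"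
  shows "sum f (\<Union>i\<in>I. A i) \<le> (\<Sum>i\<in>I. sum f (A i))"
  using assms(1,2)
proof (induction I rule: finite_induct)
  case (insert i I)
  have "sum f (A i \<union> (\<Union>i\<in>I. A i)) \<le> sum f (A i) + sum f (\<Union>i\<in>I. A i)"
    using insert assms(3) by (subst sum_Un) (auto intro!: sum_nonneg)
  also have "\<dots> \<le> sum f (A i) + (\<Sum>i\<in>I. sum f (A i))"
    using insert by auto
  finally show ?case using insert by simp
qed simp

context sgraph
begin

definition inner :: "'a list \<Rightarrow> 'a set" where
  "inner P = set P - {hd P, last P}"

definition upaths :: "'a \<Rightarrow> 'a \<Rightarrow> 'a list set" where
  "upaths u v = {P. ipath P \<and> hd P = u \<and> last P = v}"

text \<open>The relation called linked in the overview, with \<open>k\<close> as the meaning of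
  small. Separators avoid both ends, so adjacent vertices are always linked.\<close>

definition nonsep :: "nat \<Rightarrow> 'a \<Rightarrow> 'a \<Rightarrow> bool" where
  "nonsep k u v \<longleftrightarrow>
    (\<forall>X\<subseteq>V - {u, v}. alpha_le X k \<longrightarrow> (\<exists>P\<in>upaths u v. set P \<inter> X = {}))"

text \<open>The random path of the overview. Nonnegativity is demanded on all lists, which keeps the
  later union bounds free of side conditions.\<close>

definition spread :: "'a \<Rightarrow> 'a \<Rightarrow> nat \<Rightarrow> real \<Rightarrow> ('a list \<Rightarrow> real) \<Rightarrow> bool" where
  "spread u v m \<delta> p \<longleftrightarrow>
    (\<forall>P. 0 \<le> p P) \<and> sum p (upaths u v) = 1 \<and>
    (\<forall>W\<subseteq>V. alpha_le W m \<longrightarrow> sum p {P \<in> upaths u v. inner P \<inter> W \<noteq> {}} \<le> \<delta>)"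

definition heavy :: "'a \<Rightarrow> 'a \<Rightarrow> ('a list \<Rightarrow> real) \<Rightarrow> real \<Rightarrow> 'a set" where
  "heavy u v p \<epsilon> = {w \<in> V. \<epsilon> < sum p {P \<in> upaths u v. inner P \<inter> closed_nbhd w \<noteq> {}}}"

lemma finite_upaths: "finite (upaths u v)"
proof (rule finite_subset)
  show "upaths u v \<subseteq> {P. set P \<subseteq> V \<and> length P \<le> card V}"
  proof
    fix P assume "P \<in> upaths u v"
    then have "ipath P" by (simp add: upaths_def)
    then have "set P \<subseteq> V" "distinct P" by (auto dest: ipath_V ipath_distinct)
    then show "P \<in> {P. set P \<subseteq> V \<and> length P \<le> card V}"
      using card_mono[OF fin_V, of "set P"] by (auto simp: distinct_card)
  qed
qed (rule finite_lists_length_le[OF fin_V])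

lemma finite_alpha_le_family: "finite {W. W \<subseteq> V \<and> alpha_le W m}"
  using fin_V by (auto intro: finite_subset[of _ "Pow V"])

end

text \<open>A common vertex of \<open>A\<close> and \<open>B\<close> is itself a nonadjacent pair,
  so \<open>no_biclique\<close> only restricts disjoint sides. With \<open>2 \<le> a\<close>, a
  vertex whose closed neighbourhood contains \<open>a\<close> members of a stable set is not one of
  those members.\<close>

locale pfree = sgraph +
  fixes a b :: nat
  assumes two_le_a: "2 \<le> a"
    and ipath_length: "ipath p \<Longrightarrow> length p < b"
    and no_biclique: "A \<subseteq> V \<Longrightarrow> B \<subseteq> V \<Longrightarrow> indep A \<Longrightarrow> indep B \<Longrightarrow> card A = a \<Longrightarrow> card B = a \<Longrightarrow>
      \<exists>x\<in>A. \<exists>y\<in>B. \<not> E x y"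
begin

lemma card_inner: "P \<in> upaths u v \<Longrightarrow> card (inner P) \<le> b"
proof -
  assume "P \<in> upaths u v"
  then have "length P < b" using ipath_length by (simp add: upaths_def)
  moreover have "card (inner P) \<le> card (set P)"
    unfolding inner_def by (intro card_mono) auto
  ultimately show ?thesis using card_length[of P] by linarith
qed

text \<open>
  If the player choosing \<open>W\<close> could always hit the path with probability above \<open>\<delta>\<close>, then the vertices
  covered by his random \<open>W\<close> with probability at least \<open>\<delta> / b\<close> would separate \<open>u\<close> from \<open>v\<close>.
\<close>

lemma spread_exists:
  assumes ns: "nonsep k u v" and "0 < \<delta>" and mk: "real m * real b \<le> \<delta> * real k"
  shows "\<exists>p. spread u v m \<delta> p"
proof -
  define I where "I = upaths u v"
  define J where "J = {W. W \<subseteq> V \<and> alpha_le W m}"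
  \<comment> \<open>The payoff is shifted by \<delta>: a distribution with all expected payoffs at
    most 0 hits every \<open>W\<close> with probability at most \<delta>.\<close>
  define M where "M P W = (if inner P \<inter> W \<noteq> {} then 1 else 0) - \<delta>" for P W
  have fin: "finite I" "finite J"
    by (auto simp: I_def J_def finite_upaths finite_alpha_le_family)
  have "\<not> (\<exists>q. (\<forall>W\<in>J. 0 \<le> q W) \<and> (\<forall>P\<in>I. 0 < (\<Sum>W\<in>J. q W * M P W)))"
  proof
    assume "\<exists>q. (\<forall>W\<in>J. 0 \<le> q W) \<and> (\<forall>P\<in>I. 0 < (\<Sum>W\<in>J. q W * M P W))"
    then obtain q0 where q0: "\<forall>W\<in>J. 0 \<le> q0 W" "\<forall>P\<in>I. 0 < (\<Sum>W\<in>J. q0 W * M P W)" by blast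
    define q where "q W = (if W \<in> J then q0 W else 0)" for W
    have q: "0 \<le> q W" for W using q0 by (simp add: q_def)
    have hit: "\<delta> * sum q J < sum q {W \<in> J. inner P \<inter> W \<noteq> {}}" if "P \<in> I" for P
    proof -
      have "0 < (\<Sum>W\<in>J. q0 W * M P W)" using q0 that by blast
      also have "\<dots> = (\<Sum>W\<in>J. (if inner P \<inter> W \<noteq> {} then q W else 0) - \<delta> * q W)"
        by (intro sum.cong) (auto simp: q_def M_def algebra_simps)
      also have "\<dots> = sum q {W \<in> J. inner P \<inter> W \<noteq> {}} - \<delta> * sum q J"
        using fin by (simp add: sum_subtractf sum.inter_filter sum_distrib_left)
      finally show ?thesis by simp
    qed
    define c where "c x = sum q {W \<in> J. x \<in> W}" for x
    define X where "X = {x \<in> V - {u, v}. \<delta> * sum q J \<le> b * c x}"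
    obtain P0 where "P0 \<in> I"
      using ns alpha_le_empty unfolding nonsep_def I_def by blast
    have "sum q {W \<in> J. inner P0 \<inter> W \<noteq> {}} \<le> sum q J"
      using fin q by (intro sum_mono2) auto
    then have pos: "0 < sum q J"
      using hit[OF \<open>P0 \<in> I\<close>] sum_nonneg[of J q] q by (cases "sum q J = 0") auto
    \<comment> \<open>Double counting of pairs \<open>x \<in> W\<close>: each \<open>W\<close>
      contains at most \<open>m\<close> vertices of the stable set \<open>T\<close>, while each
      vertex of \<open>T\<close> is covered with at least a share \<delta> / \<open>b\<close> of the
      total weight.\<close>
    have "alpha_le X k"
      unfolding alpha_le_def
    proof (intro allI impI)
      fix T assume T: "T \<subseteq> X" "indep T"
      have finT: "finite T" using T fin_V by (auto simp: X_def intro: finite_subset)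
      have "card T * (\<delta> * sum q J) = (\<Sum>x\<in>T. \<delta> * sum q J)" by simp
      also have "\<dots> \<le> (\<Sum>x\<in>T. b * c x)"
        using T by (intro sum_mono) (auto simp: X_def)
      also have "\<dots> = b * (\<Sum>x\<in>T. \<Sum>W\<in>J. if x \<in> W then q W else 0)"
        using fin by (simp add: c_def sum.inter_filter sum_distrib_left)
      also have "\<dots> = b * (\<Sum>W\<in>J. \<Sum>x\<in>T. if x \<in> W then q W else 0)"
        by (subst sum.swap) simp
      also have "\<dots> = b * (\<Sum>W\<in>J. card {x \<in> T. x \<in> W} * q W)"
        using finT by (simp add: sum.inter_filter[symmetric])
      also have "\<dots> \<le> b * (\<Sum>W\<in>J. m * q W)"
      proof (intro mult_left_mono sum_mono mult_right_mono)
        fix W assume "W \<in> J"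
        then have "card {x \<in> T. x \<in> W} \<le> m"
          using T indep_subset by (intro alpha_leD[of W]) (auto simp: J_def indep_def)
        then show "real (card {x \<in> T. x \<in> W}) \<le> real m" by simp
      qed (use q in auto)
      also have "\<dots> = (m * b) * sum q J" by (simp add: sum_distrib_left mult_ac)
      also have "\<dots> \<le> (\<delta> * k) * sum q J" using mk pos by (intro mult_right_mono) auto
      finally have "card T * (\<delta> * sum q J) \<le> k * (\<delta> * sum q J)" by (simp add: mult_ac)
      then show "card T \<le> k" using pos \<open>0 < \<delta>\<close> by simp
    qed
    moreover have "X \<subseteq> V - {u, v}" by (auto simp: X_def)
    ultimately obtain P where P: "P \<in> I" "set P \<inter> X = {}"
      using ns unfolding nonsep_def I_def by blast
    have inn: "inner P \<subseteq> V - {u, v}"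
      using P(1) ipath_V by (auto simp: I_def upaths_def inner_def)
    have le: "b * c x \<le> \<delta> * sum q J" if "x \<in> inner P" for x
      using that inn P(2) by (force simp: X_def inner_def)
    have "b > 0" using P(1) ipath_length[of P] by (auto simp: I_def upaths_def)
    \<comment> \<open>The path avoids \<open>X\<close>, so each of its at most \<open>b\<close>
      interior vertices is covered with at most a share \<delta> / \<open>b\<close>. By the union
      bound this is too little for \<open>hit\<close>.\<close>
    have "sum q {W \<in> J. inner P \<inter> W \<noteq> {}} = sum q (\<Union>x\<in>inner P. {W \<in> J. x \<in> W})"
      by (intro arg_cong[of _ _ "sum q"]) auto
    also have "\<dots> \<le> (\<Sum>x\<in>inner P. c x)"
      unfolding c_def using fin q by (intro sum_UN_le) (auto simp: inner_def)
    finally have "b * (\<delta> * sum q J) < b * (\<Sum>x\<in>inner P. c x)"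
      using hit[OF P(1)] \<open>b > 0\<close> by simp
    also have "\<dots> = (\<Sum>x\<in>inner P. b * c x)" by (simp add: sum_distrib_left)
    also have "\<dots> \<le> card (inner P) * (\<delta> * sum q J)"
      using le by (intro sum_bounded_above[THEN order_trans]) auto
    also have "\<dots> \<le> b * (\<delta> * sum q J)"
      using card_inner[of P u v] P(1) pos \<open>0 < \<delta>\<close> by (intro mult_right_mono) (auto simp: I_def)
    finally show False by simp
  qed
  then obtain p0 where p0: "\<forall>P\<in>I. 0 \<le> p0 P" "sum p0 I = 1" "\<forall>W\<in>J. (\<Sum>P\<in>I. p0 P * M P W) \<le> 0"
    using ville_alternative[OF fin, of M] by blast
  define p where "p P = (if P \<in> I then p0 P else 0)" for P
  have "sum p {P \<in> I. inner P \<inter> W \<noteq> {}} \<le> \<delta>" if "W \<in> J" for W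
  proof -
    have "sum p {P \<in> I. inner P \<inter> W \<noteq> {}} - \<delta> * sum p I
        = (\<Sum>P\<in>I. (if inner P \<inter> W \<noteq> {} then p P else 0) - \<delta> * p P)"
      using fin by (simp add: sum_subtractf sum.inter_filter sum_distrib_left)
    also have "\<dots> = (\<Sum>P\<in>I. p0 P * M P W)"
      by (intro sum.cong) (auto simp: p_def M_def algebra_simps)
    finally show ?thesis using p0 that by (auto simp: p_def)
  qed
  moreover have "sum p I = 1" using p0 by (simp add: p_def)
  ultimately show ?thesis
    using p0(1) by (intro exI[of _ p]) (auto simp: spread_def I_def J_def p_def)
qed

text \<open>Sort the vertices of a stable set \<open>T\<close> by their trace on \<open>A\<close>.
  More than \<open>a\<close> of them with the same trace would form a forbidden biclique together
  with \<open>a\<close> vertices of that trace, and there are \<open>2 ^ card A\<close>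
  traces.\<close>

lemma alpha_le_many_neighbours:
  assumes "A \<subseteq> V" "indep A"
  shows "alpha_le {x \<in> V. a \<le> card (closed_nbhd x \<inter> A)} (a * 2 ^ card A)"
  unfolding alpha_le_def
proof (intro allI impI)
  fix T assume T: "T \<subseteq> {x \<in> V. a \<le> card (closed_nbhd x \<inter> A)}" "indep T"
  have finA: "finite A" using assms fin_V finite_subset by blast
  define fib where "fib D = {x \<in> T. closed_nbhd x \<inter> A = D}" for D
  have fib: "card (fib D) \<le> a" if "D \<in> Pow A" for D
  proof (rule ccontr)
    assume "\<not> card (fib D) \<le> a"
    then obtain B where B: "B \<subseteq> fib D" "card B = a"
      by (meson nat_le_linear obtain_subset_with_card_n)
    then obtain x0 where "x0 \<in> B" using two_le_a by fastforce
    then have "a \<le> card D" using B T by (auto simp: fib_def)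
    then obtain A' where A': "A' \<subseteq> D" "card A' = a"
      by (meson obtain_subset_with_card_n)
    have A'A: "A' \<subseteq> A" using A' that by auto
    have BT: "B \<subseteq> T" using B by (auto simp: fib_def)
    obtain x y where xy: "x \<in> A'" "y \<in> B" "\<not> E x y"
      using no_biclique[of A' B] A' B A'A BT T assms indep_subset
      by (metis (no_types, lifting) mem_Collect_eq order_trans subsetI subsetD)
    have sub: "A' \<subseteq> closed_nbhd y \<inter> A" using A' B xy(2) by (auto simp: fib_def)
    \<comment> \<open>\<open>y\<close> is adjacent to its whole trace except possibly itself, so the
      missing edge forces \<open>x = y\<close>. The stable set \<open>A\<close> then meets the
      closed neighbourhood of \<open>x\<close> in \<open>x\<close> alone, contradicting
      \<open>2 \<le> a\<close>.\<close>
    then have "x = y" using xy adj_sym by (auto simp: closed_nbhd_def)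
    then have "A' \<subseteq> {x}"
      using sub xy(1) assms(2) by (auto simp: closed_nbhd_def indep_def)
    then have "card A' \<le> 1" using card_mono[of "{x}" A'] by simp
    then show False using A' two_le_a by simp
  qed
  have T_eq: "(\<Union>D\<in>Pow A. fib D) = T"
  proof (intro equalityI subsetI)
    fix x assume "x \<in> T"
    then have "x \<in> fib (closed_nbhd x \<inter> A)" by (simp add: fib_def)
    then show "x \<in> (\<Union>D\<in>Pow A. fib D)" by (intro UN_I) auto
  next
    fix x assume "x \<in> (\<Union>D\<in>Pow A. fib D)"
    then obtain D where "x \<in> fib D" by blast
    then show "x \<in> T" by (simp add: fib_def)
  qed
  have "card T \<le> (\<Sum>D\<in>Pow A. card (fib D))"
    using card_UN_le[of "Pow A" fib] finA by (simp add: T_eq)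
  also have "\<dots> \<le> (\<Sum>D\<in>Pow A. a)" by (intro sum_mono fib)
  also have "\<dots> = a * 2 ^ card A" using finA by (simp add: card_Pow)
  finally show "card T \<le> a * 2 ^ card A" .
qed

text \<open>
  Averaging over a stable set of heavy vertices: a path meeting none of the vertices with at least \<open>a\<close>
  neighbours in it is close to at most \<open>a b\<close> of its members.
\<close>

lemma alpha_le_heavy:
  assumes sp: "spread u v m \<delta> p" and m: "a * 2 ^ M \<le> m"
    and "0 < \<epsilon>" "\<delta> \<le> \<epsilon> / 2" and M: "2 * real a * real b \<le> \<epsilon> * real M"
  shows "alpha_le (heavy u v p \<epsilon>) M"
  unfolding alpha_le_def
proof (intro allI impI, rule ccontr)
  fix A0 assume A0: "A0 \<subseteq> heavy u v p \<epsilon>" "indep A0" "\<not> card A0 \<le> M"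
  then obtain A where A: "A \<subseteq> A0" "card A = M"
    by (meson nat_le_linear obtain_subset_with_card_n)
  have AV: "A \<subseteq> V" "indep A" using A A0 indep_subset by (auto simp: heavy_def)
  have finA: "finite A" using AV fin_V finite_subset by blast
  define I where "I = upaths u v"
  have finI: "finite I" by (simp add: I_def finite_upaths)
  have p: "\<And>P. 0 \<le> p P" "sum p I = 1" using sp by (auto simp: spread_def I_def)
  then obtain P0 where "P0 \<in> I" by fastforce
  then have "b > 0" using ipath_length[of P0] by (auto simp: I_def upaths_def)
  then have "0 < 2 * real a * real b" using two_le_a by simp
  then have "M > 0" using M by (cases "M = 0") auto
  \<comment> \<open>The bound on \<alpha> for this set is exponential in \<open>M\<close>, which is
    why \<open>m\<close> has to be that large; the random path then rarely meets
    \<open>W\<close>.\<close>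
  define W where "W = {x \<in> V. a \<le> card (closed_nbhd x \<inter> A)}"
  have "alpha_le W m"
    unfolding W_def using alpha_le_many_neighbours[OF AV] A m by (auto intro: alpha_le_mono)
  then have W: "sum p {P \<in> I. inner P \<inter> W \<noteq> {}} \<le> \<delta>"
    using sp by (auto simp: spread_def I_def W_def)
  have count: "real (card {w \<in> A. inner P \<inter> closed_nbhd w \<noteq> {}})
      \<le> a * b + (if inner P \<inter> W \<noteq> {} then M else 0)" if P: "P \<in> I" for P
  proof (cases "inner P \<inter> W = {}")
    case False
    have "card {w \<in> A. inner P \<inter> closed_nbhd w \<noteq> {}} \<le> card A"
      using finA by (intro card_mono) auto
    then have "real (card {w \<in> A. inner P \<inter> closed_nbhd w \<noteq> {}}) \<le> real M" using A by simp
    then show ?thesis using False by (simp add: add_increasing)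
  next
    case True
    have inV: "inner P \<subseteq> V" using P ipath_V by (auto simp: I_def upaths_def inner_def)
    have "{w \<in> A. inner P \<inter> closed_nbhd w \<noteq> {}} \<subseteq> (\<Union>x\<in>inner P. closed_nbhd x \<inter> A)"
      using AV adj_sym by (fastforce simp: closed_nbhd_def)
    then have "card {w \<in> A. inner P \<inter> closed_nbhd w \<noteq> {}} \<le> card (\<Union>x\<in>inner P. closed_nbhd x \<inter> A)"
      using finA by (intro card_mono) (auto simp: inner_def)
    also have "\<dots> \<le> (\<Sum>x\<in>inner P. card (closed_nbhd x \<inter> A))"
      by (intro card_UN_le) (simp add: inner_def)
    also have "\<dots> \<le> (\<Sum>x\<in>inner P. a)"
      using True inV by (intro sum_mono) (force simp: W_def)
    also have "\<dots> \<le> a * b"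
      using card_inner[of P u v] P by (simp add: I_def)
    finally have "real (card {w \<in> A. inner P \<inter> closed_nbhd w \<noteq> {}}) \<le> real (a * b)"
      by (simp only: of_nat_le_iff)
    then show ?thesis using True by simp
  qed
  \<comment> \<open>Two estimates of the expected number of members of \<open>A\<close> whose closed
    neighbourhood is hit: by heaviness it exceeds \<open>\<epsilon> * M\<close>, but by
    \<open>count\<close> it is at most \<open>a * b\<close> plus \<open>M\<close> times the
    probability of meeting \<open>W\<close>.\<close>
  have "\<epsilon> * M = (\<Sum>w\<in>A. \<epsilon>)" using A by simp
  also have "\<dots> < (\<Sum>w\<in>A. sum p {P \<in> I. inner P \<inter> closed_nbhd w \<noteq> {}})"
    using A A0 finA \<open>M > 0\<close> by (intro sum_strict_mono) (auto simp: heavy_def I_def)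
  also have "\<dots> = (\<Sum>w\<in>A. \<Sum>P\<in>I. if inner P \<inter> closed_nbhd w \<noteq> {} then p P else 0)"
    using finI by (simp add: sum.inter_filter)
  also have "\<dots> = (\<Sum>P\<in>I. \<Sum>w\<in>A. if inner P \<inter> closed_nbhd w \<noteq> {} then p P else 0)"
    by (rule sum.swap)
  also have "\<dots> = (\<Sum>P\<in>I. card {w \<in> A. inner P \<inter> closed_nbhd w \<noteq> {}} * p P)"
    using finA by (simp add: sum.inter_filter[symmetric])
  also have "\<dots> \<le> (\<Sum>P\<in>I. (a * b + (if inner P \<inter> W \<noteq> {} then M else 0)) * p P)"
    using count p(1) by (intro sum_mono mult_right_mono) auto
  also have "\<dots> = (\<Sum>P\<in>I. a * b * p P + M * (if inner P \<inter> W \<noteq> {} then p P else 0))"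
    by (intro sum.cong) (auto simp: algebra_simps)
  also have "\<dots> = a * b * sum p I + M * sum p {P \<in> I. inner P \<inter> W \<noteq> {}}"
    using finI by (simp add: sum.distrib sum_distrib_left sum.inter_filter)
  also have "\<dots> \<le> a * b + M * (\<epsilon> / 2)"
    using p W assms(4) by (intro add_mono mult_left_mono) auto
  also have "\<dots> \<le> \<epsilon> * M" using M by (simp add: field_simps)
  finally show False by simp
qed

end

section \<open>Large linked families\<close>

text \<open>Counting over all maps from \<open>{..<b}\<close> to \<open>R\<close>. For fixed
  \<open>i\<close>, \<open>j\<close>, \<open>l\<close>, a bad map is determined by its values off
  \<open>l\<close> and one of at most \<open>s\<close> values at \<open>l\<close>; summed over at
  most \<open>b ^ 3\<close> triples, this leaves a map that is never bad. The case
  \<open>i = j\<close> is included and later makes \<open>f\<close> injective.\<close>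

lemma tuple_avoiding:
  fixes Z :: "'a \<Rightarrow> 'a \<Rightarrow> 'a set"
  assumes "finite R" and Z: "\<And>x y. x \<in> R \<Longrightarrow> y \<in> R \<Longrightarrow> card (Z x y \<inter> R) \<le> s"
    and big: "b ^ 3 * s < card R"
  shows "\<exists>f. (\<forall>i<b. f i \<in> R) \<and> (\<forall>i<b. \<forall>j<b. \<forall>l<b. l \<noteq> i \<longrightarrow> l \<noteq> j \<longrightarrow> f l \<notin> Z (f i) (f j))"
proof (cases "b = 0")
  case False
  define F where "F = ({..<b} \<rightarrow>\<^sub>E R)"
  have finF: "finite F" unfolding F_def using assms(1) by (intro finite_PiE) auto
  have cardF: "card F = card R * card R ^ (b - 1)"
    using False by (simp add: F_def card_PiE power_eq_if)
  define Bad where "Bad = (\<lambda>(i, j, l). {f \<in> F. f l \<in> Z (f i) (f j)})"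
  define T where "T = {(i, j, l). i < b \<and> j < b \<and> l < b \<and> l \<noteq> i \<and> l \<noteq> j}"
  have T: "T \<subseteq> {..<b} \<times> {..<b} \<times> {..<b}" by (auto simp: T_def)
  then have finT: "finite T" by (rule finite_subset) auto
  have "card T \<le> card ({..<b} \<times> {..<b} \<times> {..<b})" using T by (intro card_mono) auto
  then have cardT: "card T \<le> b ^ 3" by (simp add: card_cartesian_product power3_eq_cube)
  have bad: "card (Bad t) \<le> s * card R ^ (b - 1)" if "t \<in> T" for t
  proof -
    obtain i j l where t: "t = (i, j, l)" "i < b" "j < b" "l < b" "l \<noteq> i" "l \<noteq> j"
      using \<open>t \<in> T\<close> by (auto simp: T_def)
    define D where "D = {..<b} - {l}"
    define G where "G = (D \<rightarrow>\<^sub>E R)"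
    define S where "S = (SIGMA g:G. Z (g i) (g j) \<inter> R)"
    define h where "h f = (restrict f D, f l)" for f :: "nat \<Rightarrow> 'a"
    have finG: "finite G" unfolding G_def using assms(1) by (intro finite_PiE) (auto simp: D_def)
    have ij: "i \<in> D" "j \<in> D" using t by (auto simp: D_def)
    have "inj_on h (Bad t)"
    proof (rule inj_onI)
      fix f g assume fg: "f \<in> Bad t" "g \<in> Bad t" "h f = h g"
      have eq: "f x = g x" if "x < b" for x
      proof (cases "x = l")
        case True
        then show ?thesis using fg by (simp add: h_def)
      next
        case False
        then have "restrict f D x = restrict g D x" "x \<in> D"
          using fg that by (auto simp: h_def D_def)
        then show ?thesis by simp
      qed
      have "f \<in> {..<b} \<rightarrow>\<^sub>E R" "g \<in> {..<b} \<rightarrow>\<^sub>E R"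
        using fg by (auto simp: Bad_def F_def t)
      then show "f = g" using eq by (intro PiE_ext) auto
    qed
    moreover have "h ` Bad t \<subseteq> S"
    proof
      fix z assume "z \<in> h ` Bad t"
      then obtain f where f: "f \<in> {..<b} \<rightarrow>\<^sub>E R" "f l \<in> Z (f i) (f j)" "z = h f"
        by (auto simp: Bad_def F_def t)
      have "f x \<in> R" if "x < b" for x using f(1) that by (auto simp: PiE_iff)
      then have "restrict f D \<in> G" "f l \<in> R" using t by (auto simp: G_def D_def)
      then show "z \<in> S" using f ij by (auto simp: S_def h_def)
    qed
    moreover have "finite S" unfolding S_def using finG assms(1) by (intro finite_SigmaI) auto
    ultimately have "card (Bad t) \<le> card S" by (rule card_inj_on_le)
    also have "\<dots> = (\<Sum>g\<in>G. card (Z (g i) (g j) \<inter> R))"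
      unfolding S_def using finG assms(1) by (intro card_SigmaI) auto
    also have "\<dots> \<le> (\<Sum>g\<in>G. s)"
      using ij by (intro sum_mono Z) (auto simp: G_def PiE_iff)
    also have "\<dots> = s * card R ^ (b - 1)"
      using t by (simp add: G_def D_def card_PiE)
    finally show ?thesis .
  qed
  have "\<not> F \<subseteq> (\<Union>t\<in>T. Bad t)"
  proof
    assume "F \<subseteq> (\<Union>t\<in>T. Bad t)"
    then have "card F \<le> card (\<Union>t\<in>T. Bad t)"
      using finF finT by (intro card_mono) (auto simp: Bad_def)
    also have "\<dots> \<le> (\<Sum>t\<in>T. card (Bad t))" using finT by (rule card_UN_le)
    also have "\<dots> \<le> (\<Sum>t\<in>T. s * card R ^ (b - 1))" using bad by (rule sum_mono)
    also have "\<dots> \<le> b ^ 3 * (s * card R ^ (b - 1))" using cardT by simp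
    also have "\<dots> = (b ^ 3 * s) * card R ^ (b - 1)" by simp
    also have "\<dots> < card R * card R ^ (b - 1)" using big by (intro mult_strict_right_mono) auto
    finally show False using cardF by simp
  qed
  then obtain f where "f \<in> F" "\<forall>t\<in>T. f \<notin> Bad t" by blast
  then show ?thesis
    by (intro exI[of _ f]) (auto simp: F_def T_def Bad_def PiE_iff)
qed simp

context pfree
begin

text \<open>Union bound: were every path hit by some member of \<open>F\<close> or \<open>G\<close>,
  the total probability 1 would be at most the left side of the last premise.\<close>

lemma spread_avoid:
  fixes \<delta> \<epsilon> :: real
  assumes sp: "spread u v m \<delta> p" and fin: "finite F" "finite G"
    and F: "\<And>W. W \<in> F \<Longrightarrow> sum p {P \<in> upaths u v. inner P \<inter> W \<noteq> {}} \<le> \<delta>"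
    and G: "\<And>W. W \<in> G \<Longrightarrow> sum p {P \<in> upaths u v. inner P \<inter> W \<noteq> {}} \<le> \<epsilon>"
    and lt: "card F * \<delta> + card G * \<epsilon> < 1"
  shows "\<exists>P\<in>upaths u v. \<forall>W\<in>F \<union> G. inner P \<inter> W = {}"
proof (rule ccontr)
  define hit where "hit W = {P \<in> upaths u v. inner P \<inter> W \<noteq> {}}" for W
  have p: "\<And>P. 0 \<le> p P" "sum p (upaths u v) = 1" using sp by (auto simp: spread_def)
  have fin': "finite (hit W)" for W using finite_upaths by (simp add: hit_def)
  assume no: "\<not> ?thesis"
  have "upaths u v = (\<Union>W\<in>F. hit W) \<union> (\<Union>W\<in>G. hit W)"
  proof (intro equalityI subsetI)
    fix P assume P: "P \<in> upaths u v"
    then obtain W where "W \<in> F \<union> G" "inner P \<inter> W \<noteq> {}" using no by blast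
    then show "P \<in> (\<Union>W\<in>F. hit W) \<union> (\<Union>W\<in>G. hit W)" using P by (auto simp: hit_def)
  qed (auto simp: hit_def)
  then have "1 = sum p ((\<Union>W\<in>F. hit W) \<union> (\<Union>W\<in>G. hit W))" using p by simp
  also have "\<dots> \<le> sum p (\<Union>W\<in>F. hit W) + sum p (\<Union>W\<in>G. hit W)"
    using fin fin' p by (subst sum_Un) (auto intro!: sum_nonneg)
  also have "\<dots> \<le> (\<Sum>W\<in>F. sum p (hit W)) + (\<Sum>W\<in>G. sum p (hit W))"
    using fin fin' p by (intro add_mono sum_UN_le) auto
  also have "\<dots> \<le> (\<Sum>W\<in>F. \<delta>) + (\<Sum>W\<in>G. \<epsilon>)"
    using F G by (intro add_mono sum_mono) (auto simp: hit_def)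
  finally show False using lt by simp
qed

text \<open>
  With \<open>\<epsilon> = 1 / (8 b)\<close> and \<open>\<delta> = 1 / (16 family_bound\<^sup>2)\<close>, the bounds are chosen so that
  \<open>\<epsilon> * heavy_bound = 2 a b\<close> and \<open>\<delta> * sep_bound = hit_bound * b\<close>.
\<close>

definition heavy_bound :: nat where "heavy_bound = 16 * a * b * b"
definition hit_bound :: nat where "hit_bound = a * 2 ^ heavy_bound"
definition family_bound :: nat where "family_bound = b ^ 3 * (heavy_bound + 2) + 1"
definition sep_bound :: nat where "sep_bound = hit_bound * b * (16 * family_bound ^ 2)"

lemma heavy_bound_le_hit_bound: "heavy_bound \<le> hit_bound"
proof -
  have "heavy_bound \<le> 2 ^ heavy_bound" using less_exp[of heavy_bound] by simp
  also have "\<dots> \<le> hit_bound" using two_le_a by (simp add: hit_bound_def)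
  finally show ?thesis .
qed

text \<open>Choose \<open>f 0\<close>, ..., \<open>f (b - 1)\<close> in \<open>R\<close> such that
  none is heavy for the random path between two others. Join consecutive ones by paths that keep
  away from everything built so far and from the ends still to come; the concatenation is an induced
  path with at least \<open>b\<close> vertices.\<close>

lemma no_nonsep_family:
  assumes R: "R \<subseteq> V" "indep R" "card R = family_bound"
    and ns: "\<And>u v. u \<in> R \<Longrightarrow> v \<in> R \<Longrightarrow> u \<noteq> v \<Longrightarrow> nonsep sep_bound u v"
  shows False
proof -
  have finR: "finite R" using R fin_V finite_subset by blast
  have "family_bound > 0" by (simp add: family_bound_def)
  then obtain x0 where "x0 \<in> R" using R by fastforce
  then have b: "b \<ge> 2" using ipath_length[of "[x0]"] R by auto
  define \<delta> :: real where "\<delta> = 1 / (16 * family_bound ^ 2)"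
  define \<epsilon> :: real where "\<epsilon> = 1 / (8 * b)"
  have pos: "0 < \<delta>" "0 < \<epsilon>" using \<open>family_bound > 0\<close> b by (auto simp: \<delta>_def \<epsilon>_def)
  have "b \<le> family_bound"
  proof -
    have "b * 1 \<le> b ^ 3 * (heavy_bound + 2)"
      using b by (intro mult_mono) (auto simp: power3_eq_cube)
    then show ?thesis by (simp add: family_bound_def)
  qed
  then have "b * 1 \<le> family_bound * family_bound" using \<open>family_bound > 0\<close> by (intro mult_mono) auto
  then have "real b \<le> real family_bound ^ 2" by (simp add: power2_eq_square flip: of_nat_mult)
  then have de: "\<delta> \<le> \<epsilon> / 2" using b by (simp add: \<delta>_def \<epsilon>_def frac_le)
  have "\<exists>p. \<forall>u\<in>R. \<forall>v\<in>R. u \<noteq> v \<longrightarrow> spread u v hit_bound \<delta> (p u v)"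
  proof -
    have "real hit_bound * real b \<le> \<delta> * real sep_bound"
      using \<open>family_bound > 0\<close> by (simp add: \<delta>_def sep_bound_def)
    then have "\<forall>u v. \<exists>p. u \<in> R \<longrightarrow> v \<in> R \<longrightarrow> u \<noteq> v \<longrightarrow> spread u v hit_bound \<delta> p"
      using spread_exists ns pos by blast
    then show ?thesis by metis
  qed
  then obtain p where p: "\<And>u v. u \<in> R \<Longrightarrow> v \<in> R \<Longrightarrow> u \<noteq> v \<Longrightarrow> spread u v hit_bound \<delta> (p u v)" by blast
  define Z where "Z u v = heavy u v (p u v) \<epsilon>" for u v
  have Z: "alpha_le (Z u v) heavy_bound" if "u \<in> R" "v \<in> R" "u \<noteq> v" for u v
    unfolding Z_def
  proof (rule alpha_le_heavy[OF p[OF that]])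
    show "2 * real a * real b \<le> \<epsilon> * real heavy_bound"
      using b by (simp add: \<epsilon>_def heavy_bound_def)
  qed (use pos de in \<open>auto simp: hit_bound_def\<close>)
  \<comment> \<open>Adding the two ends makes the chosen vertices distinct and costs the 2 in
    \<open>heavy_bound + 2\<close>. On the diagonal there is no controlled heavy set, so only the
    vertex itself remains.\<close>
  define Z' where "Z' u v = (if u = v then {} else Z u v) \<union> {u, v}" for u v
  have "\<exists>f. (\<forall>i<b. f i \<in> R) \<and> (\<forall>i<b. \<forall>j<b. \<forall>l<b. l \<noteq> i \<longrightarrow> l \<noteq> j \<longrightarrow> f l \<notin> Z' (f i) (f j))"
  proof (rule tuple_avoiding[OF finR])
    fix u v assume uv: "u \<in> R" "v \<in> R"
    have "alpha_le (if u = v then {} else Z u v) heavy_bound"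
      using Z uv by (auto intro: alpha_le_empty)
    then have "alpha_le (insert u (insert v (if u = v then {} else Z u v))) (Suc (Suc heavy_bound))"
      by (intro alpha_le_insert)
    then show "card (Z' u v \<inter> R) \<le> heavy_bound + 2"
      using R indep_subset[of R "Z' u v \<inter> R"]
      by (auto simp: Z'_def alpha_le_def)
  qed (simp add: R family_bound_def)
  then obtain f where fR: "\<And>i. i < b \<Longrightarrow> f i \<in> R"
    and f: "\<And>i j l. i < b \<Longrightarrow> j < b \<Longrightarrow> l < b \<Longrightarrow> l \<noteq> i \<Longrightarrow> l \<noteq> j \<Longrightarrow> f l \<notin> Z' (f i) (f j)"
    by blast
  have fne: "f l \<noteq> f i" if "i < b" "l < b" "l \<noteq> i" for i l
    using f[of i i l] that by (auto simp: Z'_def)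
  have fZ: "f l \<notin> Z (f i) (f j)" if "i < b" "j < b" "l < b" "l \<noteq> i" "l \<noteq> j" "i \<noteq> j" for i j l
    using f[of i j l] fne[of i j] that by (auto simp: Z'_def)
  have fnadj: "f i \<notin> closed_nbhd (f l)" if "i < b" "l < b" "l \<noteq> i" for i l
    using R(2) fR that fne[of i l] by (auto simp: closed_nbhd_def indep_def)
  \<comment> \<open>Induction on the number of joined paths. Each vertex of \<open>Q\<close> is an
    earlier chosen end or lies outside every heavy set, so the next random path rarely comes near
    it; and \<open>Q\<close> keeps away from all later ends. Each path contributes at least its
    first vertex.\<close>
  have "\<exists>Q. ipath (Q @ [f n]) \<and> n \<le> length Q
      \<and> (\<forall>w\<in>set Q. (\<exists>l<n. w = f l) \<or> (\<forall>u\<in>R. \<forall>v\<in>R. u \<noteq> v \<longrightarrow> w \<notin> Z u v))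
      \<and> (\<forall>w\<in>set Q. \<forall>l. n < l \<and> l < b \<longrightarrow> w \<notin> closed_nbhd (f l))" if "n < b" for n
    using that
  proof (induction n)
    case 0
    then show ?case using fR R by (intro exI[of _ "[]"]) auto
  next
    case (Suc n)
    then obtain Q where Q: "ipath (Q @ [f n])" "n \<le> length Q"
      and Q1: "\<And>w. w \<in> set Q \<Longrightarrow> (\<exists>l<n. w = f l) \<or> (\<forall>u\<in>R. \<forall>v\<in>R. u \<noteq> v \<longrightarrow> w \<notin> Z u v)"
      and Q2: "\<And>w l. w \<in> set Q \<Longrightarrow> n < l \<Longrightarrow> l < b \<Longrightarrow> w \<notin> closed_nbhd (f l)"
      by (auto simp: Suc_lessD)
    define u where "u = f n"
    define v where "v = f (Suc n)"
    have uv: "u \<in> R" "v \<in> R" "u \<noteq> v" using Suc.prems fR fne by (auto simp: u_def v_def)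
    note sp = p[OF uv]
    \<comment> \<open>\<open>F\<close> collects the heavy sets, each hit with probability at most
      \<delta>; avoiding them preserves the invariant. \<open>G\<close>, defined below, collects the
      closed neighbourhoods to be avoided, each hit with probability at most \<epsilon> because its
      centre is not heavy. The total is at most 1/16 + 1/4.\<close>
    define F where "F = (\<lambda>(x, y). Z x y) ` {(x, y). x \<in> R \<and> y \<in> R \<and> x \<noteq> y}"
    define H where "H = set Q \<union> f ` {Suc (Suc n)..<b}"
    define G where "G = closed_nbhd ` H"
    have QV: "set Q \<subseteq> V" using ipath_V[OF Q(1)] by auto
    have H: "w \<in> V \<and> w \<notin> Z u v" if "w \<in> H" for w
    proof (cases "w \<in> set Q")
      case True
      then show ?thesis
        using Q1[OF True] uv QV Suc.prems fZ[of n "Suc n"] by (auto simp: u_def v_def)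
    next
      case False
      then obtain l where "w = f l" "Suc n < l" "l < b" using \<open>w \<in> H\<close> by (auto simp: H_def)
      then show ?thesis using fR R fZ[of n "Suc n" l] by (auto simp: u_def v_def)
    qed
    have pairs: "{(x, y). x \<in> R \<and> y \<in> R \<and> x \<noteq> y} \<subseteq> R \<times> R" by auto
    then have "card F \<le> card (R \<times> R)"
      unfolding F_def using finR
      by (meson card_image_le card_mono finite_SigmaI finite_subset le_trans)
    then have "card F \<le> family_bound ^ 2" by (simp add: card_cartesian_product R power2_eq_square)
    then have "real (card F) \<le> real family_bound ^ 2"
      by (metis of_nat_le_iff of_nat_power)
    then have "card F * \<delta> \<le> real family_bound ^ 2 * \<delta>" using pos by (intro mult_right_mono) auto
    also have "\<dots> = 1 / 16" using \<open>family_bound > 0\<close> by (simp add: \<delta>_def)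
    finally have cF: "card F * \<delta> \<le> 1 / 16" .
    have "card G \<le> card H" unfolding G_def by (rule card_image_le) (simp add: H_def)
    also have "\<dots> \<le> card (set Q) + card (f ` {Suc (Suc n)..<b})" unfolding H_def by (rule card_Un_le)
    also have "\<dots> \<le> b + b"
    proof (rule add_mono)
      show "card (set Q) \<le> b" using card_length[of Q] ipath_length[OF Q(1)] by simp
      show "card (f ` {Suc (Suc n)..<b}) \<le> b"
        by (rule order_trans[OF card_image_le]) auto
    qed
    finally have "real (card G) \<le> 2 * real b" by simp
    then have "card G * \<epsilon> \<le> (2 * real b) * \<epsilon>" using pos by (intro mult_right_mono) auto
    also have "\<dots> = 1 / 4" using b by (simp add: \<epsilon>_def)
    finally have cG: "card G * \<epsilon> \<le> 1 / 4" .
    have "\<exists>P\<in>upaths u v. \<forall>W\<in>F \<union> G. inner P \<inter> W = {}"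
    proof (rule spread_avoid[OF sp])
      have "finite {(x, y). x \<in> R \<and> y \<in> R \<and> x \<noteq> y}"
        using pairs finR finite_subset by blast
      then show "finite F" by (simp add: F_def)
      show "finite G" by (simp add: G_def H_def)
      fix W
      assume "W \<in> F"
      then obtain x y where xy: "W = Z x y" "x \<in> R" "y \<in> R" "x \<noteq> y" by (auto simp: F_def)
      then have "alpha_le W hit_bound" using Z heavy_bound_le_hit_bound alpha_le_mono by blast
      moreover have "W \<subseteq> V" using xy by (auto simp: Z_def heavy_def)
      ultimately show "sum (p u v) {P \<in> upaths u v. inner P \<inter> W \<noteq> {}} \<le> \<delta>"
        using sp by (simp add: spread_def)
    next
      fix W assume "W \<in> G"
      then obtain w where "w \<in> H" "W = closed_nbhd w" by (auto simp: G_def)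
      then show "sum (p u v) {P \<in> upaths u v. inner P \<inter> W \<noteq> {}} \<le> \<epsilon>"
        using H[of w] by (simp add: Z_def heavy_def not_less)
    next
      show "card F * \<delta> + card G * \<epsilon> < 1" using cF cG by linarith
    qed
    then obtain P where P: "ipath P" "hd P = u" "last P = v"
      and PF: "\<And>W. W \<in> F \<Longrightarrow> inner P \<inter> W = {}" and PG: "\<And>W. W \<in> G \<Longrightarrow> inner P \<inter> W = {}"
      by (auto simp: upaths_def)
    obtain t where t: "P = u # t @ [v]"
    proof -
      from P obtain t0 where t0: "P = u # t0" by (cases P) auto
      with P uv have "t0 \<noteq> []" by auto
      with P t0 have "P = u # butlast t0 @ [v]"
        by (metis append_butlast_last_id last_ConsR)
      then show thesis by (rule that)
    qed
    have inn: "inner P = set t"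
      using ipath_distinct[OF P(1)] by (auto simp: inner_def t)
    have tV: "set t \<subseteq> V" using ipath_V[OF P(1)] t by auto
    have tZ: "x \<notin> Z y z" if "x \<in> set t" "y \<in> R" "z \<in> R" "y \<noteq> z" for x y z
      using PF[of "Z y z"] that inn by (auto simp: F_def)
    have tH: "x \<notin> closed_nbhd w" if "x \<in> set t" "w \<in> H" for x w
      using PG[of "closed_nbhd w"] that inn by (auto simp: G_def)
    have "ipath (Q @ u # (t @ [v]))"
    proof (rule ipath_glue)
      show "ipath (Q @ [u])" using Q by (simp add: u_def)
      show "ipath (u # t @ [v])" using P t by simp
      fix w x assume w: "w \<in> set Q" and x: "x \<in> set (t @ [v])"
      show "w \<noteq> x \<and> \<not> E w x"
      proof (cases "x \<in> set t")
        case True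
        then have "x \<notin> closed_nbhd w" using tH w by (simp add: H_def)
        then show ?thesis using True tV by (auto simp: closed_nbhd_def)
      next
        case False
        then have "x = v" using x by simp
        moreover have "w \<notin> closed_nbhd v" using Q2[OF w, of "Suc n"] Suc.prems by (simp add: v_def)
        ultimately show ?thesis using w QV adj_sym[of w v] by (auto simp: closed_nbhd_def)
      qed
    qed
    moreover have "(\<exists>l<Suc n. w = f l) \<or> (\<forall>u\<in>R. \<forall>v\<in>R. u \<noteq> v \<longrightarrow> w \<notin> Z u v)"
      if "w \<in> set (Q @ u # t)" for w
    proof -
      consider "w \<in> set Q" | "w = f n" | "w \<in> set t" using \<open>w \<in> _\<close> u_def by auto
      then show ?thesis
      proof cases
        case 1
        then show ?thesis using Q1[OF 1] less_SucI by blast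
      qed (use tZ in auto)
    qed
    moreover have "w \<notin> closed_nbhd (f l)" if "w \<in> set (Q @ u # t)" "Suc n < l \<and> l < b" for w l
    proof -
      consider "w \<in> set Q" | "w = f n" | "w \<in> set t" using \<open>w \<in> _\<close> u_def by auto
      then show ?thesis
      proof cases
        case 1
        then show ?thesis using Q2[OF 1, of l] that(2) by simp
      next
        case 2
        then show ?thesis using fnadj[of n l] that(2) by simp
      next
        case 3
        moreover have "f l \<in> H" using that(2) by (simp add: H_def)
        ultimately show ?thesis using tH by blast
      qed
    qed
    ultimately show ?case
      using Q(2) by (intro exI[of _ "Q @ u # t"]) (simp add: v_def)
  qed
  from this[of "b - 1"] b obtain Q where "ipath (Q @ [f (b - 1)])" "b - 1 \<le> length Q"
    by auto
  then show False using ipath_length[of "Q @ [f (b - 1)]"] b by simp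
qed

end

section \<open>Balanced separators\<close>

context pfree
begin

text \<open>\<open>family_bound\<close> pays for the set deleted at the start. The factor
  \<open>b + 1\<close> covers the at most \<open>b\<close> separators collected along the path and
  makes \<open>sep_bound \<le> balanced_bound\<close> immediate.\<close>

definition balanced_bound :: nat where "balanced_bound = family_bound + (b + 1) * sep_bound"

lemma balanced_separator:
  assumes S: "S \<subseteq> V"
  shows "\<exists>X\<subseteq>V. alpha_le X balanced_bound \<and> (\<forall>C\<subseteq>V - X. conn C \<longrightarrow> 2 * card (S \<inter> C) \<le> card S)"
proof (rule ccontr)
  assume no: "\<not> ?thesis"
  define good where "good X C \<longleftrightarrow> C \<subseteq> V - X \<and> conn C \<and> card S < 2 * card (S \<inter> C)" for X C
  \<comment> \<open>Two sets that each contain more than half of \<open>S\<close> meet, so for small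
    \<open>X\<close> the union of all these connected sets is again one of them: the big component
    of \<open>V - X\<close>.\<close>
  define B where "B X = \<Union>{C. good X C}" for X
  have finS: "finite S" using S fin_V finite_subset by blast
  have ex: "\<exists>C. good X C" if "X \<subseteq> V" "alpha_le X balanced_bound" for X
    using no that by (fastforce simp: good_def not_le)
  have B_good: "good X (B X)" if X: "X \<subseteq> V" "alpha_le X balanced_bound" for X
  proof -
    have "conn (B X)"
      unfolding B_def
    proof (rule conn_Un_family)
      fix C D assume CD: "C \<in> {C. good X C}" "D \<in> {C. good X C}"
      show "C \<inter> D \<noteq> {}"
      proof
        assume "C \<inter> D = {}"
        then have "card (S \<inter> C) + card (S \<inter> D) = card ((S \<inter> C) \<union> (S \<inter> D))"
          using finS by (intro card_Un_disjoint[symmetric]) auto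
        also have "\<dots> \<le> card S" using finS by (intro card_mono) auto
        finally show False using CD by (auto simp: good_def)
      qed
    qed (simp add: good_def)
    moreover obtain C where C: "good X C" using ex X by blast
    then have "card (S \<inter> C) \<le> card (S \<inter> B X)"
      using finS by (intro card_mono) (auto simp: B_def)
    moreover have "B X \<subseteq> V - X" by (auto simp: B_def good_def)
    ultimately show ?thesis using C by (auto simp: good_def)
  qed
  have B_mono: "B Y \<subseteq> B X" if "X \<subseteq> Y" for X Y
    using that by (auto simp: B_def good_def)
  \<comment> \<open>Otherwise \<open>v\<close> could be added to the maximal set
    \<open>B X\<close>.\<close>
  have B_closed: "\<not> E v w" if "X \<subseteq> V" "alpha_le X balanced_bound" "v \<in> V - X" "v \<notin> B X" "w \<in> B X" for X v w
  proof
    assume "E v w"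
    have g: "good X (B X)" using B_good that by blast
    have "card (S \<inter> B X) \<le> card (S \<inter> insert v (B X))"
      using finS by (intro card_mono) auto
    then have "good X (insert v (B X))"
      using g that conn_insert[OF _ \<open>w \<in> B X\<close> \<open>E v w\<close>] by (auto simp: good_def)
    then have "insert v (B X) \<subseteq> B X" unfolding B_def by blast
    then show False using that by blast
  qed
  define L where "L = {v \<in> V. \<forall>X\<subseteq>V. alpha_le X sep_bound \<longrightarrow> v \<notin> X \<longrightarrow> v \<in> B X}"
  have LV: "L \<subseteq> V" by (auto simp: L_def)
  have sep_le_balanced: "sep_bound \<le> balanced_bound" by (simp add: balanced_bound_def)
  \<comment> \<open>Two members of \<open>L\<close> outside a small \<open>X\<close> both lie in the
    connected set \<open>B X\<close> and are therefore linked, so \<open>no_nonsep_family\<close>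
    applies to stable subsets of \<open>L\<close>.\<close>
  have L: "alpha_le L family_bound"
    unfolding alpha_le_def
  proof (intro allI impI, rule ccontr)
    fix T assume T: "T \<subseteq> L" "indep T" "\<not> card T \<le> family_bound"
    then obtain R where R: "R \<subseteq> T" "card R = family_bound"
      by (meson nat_le_linear obtain_subset_with_card_n)
    show False
    proof (rule no_nonsep_family[of R])
      fix u v assume uv: "u \<in> R" "v \<in> R" "u \<noteq> v"
      show "nonsep sep_bound u v"
        unfolding nonsep_def
      proof (intro allI impI)
        fix X assume X: "X \<subseteq> V - {u, v}" "alpha_le X sep_bound"
        then have "u \<in> B X" "v \<in> B X" using uv R T unfolding L_def by blast+
        moreover have g: "good X (B X)"
          using X sep_le_balanced by (intro B_good) (auto intro: alpha_le_mono)
        ultimately have "reach (B X) u v" by (auto simp: good_def conn_def)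
        then obtain P where "ipath P" "hd P = u" "last P = v" "set P \<subseteq> B X"
          using reach_ipath \<open>u \<in> B X\<close> g unfolding good_def by blast
        then show "\<exists>P\<in>upaths u v. set P \<inter> X = {}"
          using g unfolding good_def upaths_def by blast
      qed
    qed (use R T LV indep_subset in auto)
  qed
  have sep: "\<exists>X\<subseteq>V. alpha_le X sep_bound \<and> v \<notin> X \<and> v \<notin> B X" if "v \<in> V - L" for v
    using that by (auto simp: L_def)
  \<comment> \<open>Invariant: the induced path \<open>q @ [v]\<close> is attached to the connected
    region \<open>C\<close> only through its end \<open>v\<close>, and \<open>C\<close> contains the
    big component left by \<open>Y\<close>. The set \<open>Y\<close> gathers \<open>L\<close> and
    one separator per step.\<close>
  have gyarfas: "\<exists>Y q v C. Y \<subseteq> V \<and> L \<subseteq> Y \<and> alpha_le Y (family_bound + n * sep_bound) \<and> ipath (q @ [v]) \<and> n \<le> length q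
      \<and> v \<in> C \<and> C \<subseteq> V - L \<and> conn C \<and> B Y \<subseteq> C \<and> (\<forall>w\<in>set q. \<forall>x\<in>C - {v}. w \<noteq> x \<and> \<not> E w x)"
    if "n \<le> b" for n
    using that
  proof (induction n)
    case 0
    have "good L (B L)"
      using LV L by (intro B_good) (auto simp: balanced_bound_def intro: alpha_le_mono)
    moreover from this obtain v where "v \<in> B L" by (fastforce simp: good_def)
    ultimately show ?case
      using LV L
      by - (rule exI[of _ L], rule exI[of _ "[]"], rule exI[of _ v], rule exI[of _ "B L"], auto simp: good_def)
  next
    case (Suc n)
    then obtain Y q v C where Y: "Y \<subseteq> V" "L \<subseteq> Y" "alpha_le Y (family_bound + n * sep_bound)"
      and q: "ipath (q @ [v])" "n \<le> length q"
      and C: "v \<in> C" "C \<subseteq> V - L" "conn C" "B Y \<subseteq> C"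
      and qC: "\<And>w x. w \<in> set q \<Longrightarrow> x \<in> C \<Longrightarrow> x \<noteq> v \<Longrightarrow> w \<noteq> x \<and> \<not> E w x"
      by (auto dest: Suc_leD)
    obtain X where X: "X \<subseteq> V" "alpha_le X sep_bound" "v \<notin> X" "v \<notin> B X" using sep C by blast
    define Y' where "Y' = Y \<union> X"
    have Y': "Y' \<subseteq> V" "L \<subseteq> Y'" using X Y by (auto simp: Y'_def)
    have alphaY': "alpha_le Y' (family_bound + Suc n * sep_bound)"
      using alpha_le_Un[OF Y(3) X(2)] by (simp add: Y'_def add_ac)
    have "family_bound + Suc n * sep_bound \<le> balanced_bound"
      unfolding balanced_bound_def using Suc.prems by (intro add_mono mult_right_mono) auto
    then have g: "good Y' (B Y')" using Y' alphaY' by (intro B_good) (auto intro: alpha_le_mono)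
    then obtain y where y: "y \<in> B Y'" by (fastforce simp: good_def)
    have BX: "B Y' \<subseteq> B X" and BY: "B Y' \<subseteq> B Y" using B_mono by (auto simp: Y'_def)
    have v_not: "v \<notin> B Y'" using BX X by blast
    have v_nadj: "\<not> E v w" if "w \<in> B Y'" for w
      proof (rule B_closed[OF X(1) _ _ X(4)])
      show "alpha_le X balanced_bound" using X(2) sep_le_balanced by (rule alpha_le_mono)
      show "v \<in> V - X" using C X by blast
      show "w \<in> B X" using that BX by blast
    qed
    have "reach C v y" using C BY y by (auto simp: conn_def)
    then obtain p where p: "ipath p" "hd p = v" "last p = y" "set p \<subseteq> C"
      using reach_ipath[of C v y] C by blast
    have "y \<in> set p" using p(1,3) ipath_ne last_in_set by blast
    then have "\<exists>x\<in>set p. x \<in> B Y'" using y by blast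
    from split_list_first_prop[OF this]
    obtain ys y' zs where ys: "p = ys @ y' # zs" "y' \<in> B Y'" "\<forall>x\<in>set ys. x \<notin> B Y'"
      by (elim exE conjE) (rule that)
    have ys_ne: "ys \<noteq> []" using ys p(2) v_not by auto
    have ys_eq: "ys @ y' # zs = butlast ys @ last ys # y' # zs"
      using append_butlast_last_id[OF ys_ne] by (metis append.assoc append_Cons append_Nil)
    have "E (last ys) y'"
      using p(1) unfolding ys(1) ys_eq by (rule ipath_last_edge)
    \<comment> \<open>Stop at the first vertex \<open>x\<close> of the route with a neighbour in
      \<open>B Y'\<close>. All earlier vertices lie outside \<open>B Y'\<close> and have no
      neighbour in it, so \<open>insert x (B Y')\<close> can serve as the next region.\<close>
    then have "\<exists>x\<in>set ys. \<exists>w\<in>B Y'. E x w" using ys ys_ne last_in_set by blast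
    from split_list_first_prop[OF this]
    obtain r x s where r: "ys = r @ x # s" "\<exists>w\<in>B Y'. E x w" "\<forall>z\<in>set r. \<not> (\<exists>w\<in>B Y'. E z w)"
      by (elim exE conjE) (rule that)
    obtain w0 where w0: "w0 \<in> B Y'" "E x w0" using r by blast
    have "hd ys = v" using p(2) ys(1) ys_ne by simp
    \<comment> \<open>\<open>X\<close> keeps \<open>v\<close> from having neighbours in
      \<open>B Y'\<close>, so \<open>x\<close> is not \<open>v\<close> and the path really
      grows.\<close>
    then have "r \<noteq> []" using r(1) v_nadj w0 by (cases r) auto
    then obtain r' where r': "r = v # r'" using \<open>hd ys = v\<close> r(1) by (cases r) auto
    have ip: "ipath (v # (r' @ [x]))"
      using p(1) ys(1) r(1) r' ipath_append1[of "v # r' @ [x]" "s @ y' # zs"] by simp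
    have sub: "set (r' @ [x]) \<subseteq> C" using p(4) ys(1) r(1) r' by auto
    have vx: "v \<notin> set (r' @ [x])" using ipath_distinct[OF ip] by simp
    have "ipath (q @ v # (r' @ [x]))"
      using q(1) ip
    proof (rule ipath_glue)
      fix w z assume "w \<in> set q" "z \<in> set (r' @ [x])"
      then show "w \<noteq> z \<and> \<not> E w z" using qC sub vx by blast
    qed
    moreover have "conn (insert x (B Y'))"
      using g w0 by (intro conn_insert) (auto simp: good_def)
    moreover have "insert x (B Y') \<subseteq> V - L"
      using sub C BY by auto
    moreover have "w \<noteq> z \<and> \<not> E w z"
      if "w \<in> set (q @ v # r')" "z \<in> insert x (B Y') - {x}" for w z
    proof -
      have z: "z \<in> B Y'" "z \<noteq> v" "z \<in> C" using that(2) v_not BY C by auto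
      show ?thesis
      proof (cases "w \<in> set q")
        case True
        then show ?thesis using qC z by blast
      next
        case False
        then have "w \<in> set r" using that(1) r' by simp
        then show ?thesis using r(1,3) ys(3) z by auto
      qed
    qed
    moreover have "Suc n \<le> length (q @ v # r')" using q by simp
    ultimately show ?case
      using Y' alphaY'
      by - (rule exI[of _ Y'], rule exI[of _ "q @ v # r'"], rule exI[of _ x],
        rule exI[of _ "insert x (B Y')"], auto)
  qed
  obtain q v where "ipath (q @ [v])" "b \<le> length q" using gyarfas[of b] by blast
  then show False using ipath_length[of "q @ [v]"] by simp
qed

end

section \<open>From balanced separators to tree decompositions\<close>

context sgraph
begin

text \<open>
  The decomposition tree has nodes \<open>{..<n}\<close>, root \<open>0\<close>, and an edge from each node \<open>i > 0\<close> to \<open>par i < i\<close>;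
  the value \<open>par 0\<close> is irrelevant. A set of nodes is connected iff all its members but one have their parent in it.
\<close>

definition tdec :: "nat \<Rightarrow> (nat \<Rightarrow> nat) \<Rightarrow> (nat \<Rightarrow> 'a set) \<Rightarrow> 'a set \<Rightarrow> bool" where
  "tdec n par \<beta> U \<longleftrightarrow>
    0 < n \<and> (\<forall>i. 0 < i \<and> i < n \<longrightarrow> par i < i) \<and> (\<Union>i<n. \<beta> i) = U \<and>
    (\<forall>u\<in>U. \<forall>v\<in>U. E u v \<longrightarrow> (\<exists>i<n. u \<in> \<beta> i \<and> v \<in> \<beta> i)) \<and>
    (\<forall>v\<in>U. \<exists>r<n. v \<in> \<beta> r \<and> (\<forall>t<n. v \<in> \<beta> t \<and> t \<noteq> r \<longrightarrow> 0 < t \<and> v \<in> \<beta> (par t)))"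

text \<open>The root bag \<open>D\<close> is named because decompositions are glued at their
  roots.\<close>

definition rooted_tdec :: "nat \<Rightarrow> 'a set \<Rightarrow> 'a set \<Rightarrow> bool" where
  "rooted_tdec k U D \<longleftrightarrow> (\<exists>n par \<beta>. tdec n par \<beta> U \<and> \<beta> 0 = D \<and> (\<forall>i<n. alpha_le (\<beta> i) k))"

lemma rooted_tdec_single: "alpha_le U k \<Longrightarrow> rooted_tdec k U U"
  unfolding rooted_tdec_def tdec_def
  by (intro exI[of _ 1] exI[of _ "\<lambda>_. 0"] exI[of _ "\<lambda>_. U"]) auto

text \<open>The second tree, shifted by \<open>n1\<close>, is hung below the root of the first.
  Common vertices lie in both root bags, so their nodes in the second tree connect through its root
  to those in the first.\<close>

lemma tdec_glue:
  assumes t1: "tdec n1 par1 \<beta>1 U1" and t2: "tdec n2 par2 \<beta>2 U2"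
    and int: "U1 \<inter> U2 \<subseteq> \<beta>1 0" "U1 \<inter> U2 \<subseteq> \<beta>2 0"
    and edges: "\<And>u v. u \<in> U1 \<Longrightarrow> v \<in> U2 \<Longrightarrow> E u v \<Longrightarrow> u \<in> U2 \<or> v \<in> U1"
    and par: "par = (\<lambda>i. if i < n1 then par1 i else if i = n1 then 0 else n1 + par2 (i - n1))"
    and \<beta>: "\<beta> = (\<lambda>i. if i < n1 then \<beta>1 i else \<beta>2 (i - n1))"
  shows "tdec (n1 + n2) par \<beta> (U1 \<union> U2)"
proof -
  have n: "0 < n1" "0 < n2" using t1 t2 by (auto simp: tdec_def)
  have par1: "\<And>i. 0 < i \<Longrightarrow> i < n1 \<Longrightarrow> par1 i < i" using t1 by (auto simp: tdec_def)
  have par2: "\<And>i. 0 < i \<Longrightarrow> i < n2 \<Longrightarrow> par2 i < i" using t2 by (auto simp: tdec_def)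
  have \<beta>_left: "\<beta> i = \<beta>1 i" if "i < n1" for i using that by (simp add: \<beta>)
  have \<beta>_right: "\<beta> (n1 + i) = \<beta>2 i" for i by (simp add: \<beta>)
  have U1: "(\<Union>i<n1. \<beta>1 i) = U1" and U2: "(\<Union>i<n2. \<beta>2 i) = U2"
    using t1 t2 by (auto simp: tdec_def)
  have e1: "\<forall>u\<in>U1. \<forall>v\<in>U1. E u v \<longrightarrow> (\<exists>i<n1. u \<in> \<beta>1 i \<and> v \<in> \<beta>1 i)"
    using t1 by (simp add: tdec_def)
  have e2: "\<forall>u\<in>U2. \<forall>v\<in>U2. E u v \<longrightarrow> (\<exists>i<n2. u \<in> \<beta>2 i \<and> v \<in> \<beta>2 i)"
    using t2 by (simp add: tdec_def)
  have top1: "\<forall>v\<in>U1. \<exists>r<n1. v \<in> \<beta>1 r \<and> (\<forall>t<n1. v \<in> \<beta>1 t \<and> t \<noteq> r \<longrightarrow> 0 < t \<and> v \<in> \<beta>1 (par1 t))"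
    using t1 by (simp add: tdec_def)
  have split: "t < n1 + n2 \<longleftrightarrow> t < n1 \<or> (\<exists>s<n2. t = n1 + s)" for t
    by (metis add_diff_inverse_nat nat_add_left_cancel_less trans_less_add1)
  have "par i < i" if "0 < i" "i < n1 + n2" for i
  proof (cases "i < n1")
    case True
    then show ?thesis using that par1 by (simp add: par)
  next
    case False
    then obtain s where "s < n2" "i = n1 + s" using split[of i] \<open>i < n1 + n2\<close> by blast
    then show ?thesis using n par2[of s] by (cases "s = 0") (auto simp: par)
  qed
  moreover have "(\<Union>i<n1 + n2. \<beta> i) = U1 \<union> U2"
  proof -
    have "(\<Union>i<n1 + n2. \<beta> i) = (\<Union>i<n1. \<beta> i) \<union> (\<Union>i<n2. \<beta> (n1 + i))"
      using split by blast
    then show ?thesis using \<beta>_left \<beta>_right U1 U2 by simp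
  qed
  moreover have "\<exists>i<n1 + n2. u \<in> \<beta> i \<and> v \<in> \<beta> i" if "u \<in> U1 \<union> U2" "v \<in> U1 \<union> U2" "E u v" for u v
  proof -
    have "(u \<in> U1 \<and> v \<in> U1) \<or> (u \<in> U2 \<and> v \<in> U2)"
      using that edges[of u v] edges[of v u] adj_sym by blast
    then show ?thesis
    proof
      assume "u \<in> U1 \<and> v \<in> U1"
      then obtain i where "i < n1" "u \<in> \<beta>1 i" "v \<in> \<beta>1 i"
        using e1 \<open>E u v\<close> by blast
      then show ?thesis using \<beta>_left by (intro exI[of _ i]) auto
    next
      assume "u \<in> U2 \<and> v \<in> U2"
      then obtain i where "i < n2" "u \<in> \<beta>2 i" "v \<in> \<beta>2 i"
        using e2 \<open>E u v\<close> by blast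
      then show ?thesis using \<beta>_right by (intro exI[of _ "n1 + i"]) auto
    qed
  qed
  moreover have "\<exists>r<n1 + n2. v \<in> \<beta> r \<and>
      (\<forall>t<n1 + n2. v \<in> \<beta> t \<and> t \<noteq> r \<longrightarrow> 0 < t \<and> v \<in> \<beta> (par t))" if v: "v \<in> U1 \<union> U2" for v
  proof -
    have top2: "\<exists>r<n2. v \<in> \<beta>2 r \<and> (\<forall>t<n2. v \<in> \<beta>2 t \<and> t \<noteq> r \<longrightarrow> 0 < t \<and> v \<in> \<beta>2 (par2 t))"
      if "v \<in> U2" using t2 that by (simp add: tdec_def)
    show ?thesis
    proof (cases "v \<in> U1")
      case True
      then obtain r where r: "r < n1" "v \<in> \<beta>1 r"
        "\<And>t. t < n1 \<Longrightarrow> v \<in> \<beta>1 t \<Longrightarrow> t \<noteq> r \<Longrightarrow> 0 < t \<and> v \<in> \<beta>1 (par1 t)"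
        using top1 by blast
      have "0 < t \<and> v \<in> \<beta> (par t)" if t: "t < n1 + n2" "v \<in> \<beta> t" "t \<noteq> r" for t
      proof (cases "t < n1")
        case lt: True
        then have "0 < t" "v \<in> \<beta>1 (par1 t)" using r(3)[of t] t by (auto simp: \<beta>_left)
        moreover have "par1 t < n1" using par1[of t] lt \<open>0 < t\<close> by linarith
        ultimately show ?thesis using lt by (simp add: par \<beta>_left)
      next
        case False
        then obtain s where s: "s < n2" "t = n1 + s" using t(1) split by blast
        have "v \<in> \<beta>2 s" using t(2) s \<beta>_right by simp
        then have "v \<in> U2" using U2 s by blast
        then have v0: "v \<in> \<beta>1 0" "v \<in> \<beta>2 0" using int \<open>v \<in> U1\<close> by auto
        show ?thesis
        proof (cases "s = 0")
          case True
          then show ?thesis using s n v0 by (simp add: par \<beta>_left)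
        next
          case pos: False
          obtain r2 where r2: "r2 < n2" "\<And>t. t < n2 \<Longrightarrow> v \<in> \<beta>2 t \<Longrightarrow> t \<noteq> r2 \<Longrightarrow> 0 < t \<and> v \<in> \<beta>2 (par2 t)"
            using top2[OF \<open>v \<in> U2\<close>] by blast
          \<comment> \<open>Node 0 has no parent, so a vertex in the root bag has 0 as its topmost
            node.\<close>
          have "r2 = 0" using r2(2)[of 0] n v0 by auto
          then have "v \<in> \<beta>2 (par2 s)" using r2(2)[of s] s \<open>v \<in> \<beta>2 s\<close> pos by auto
          then show ?thesis using s pos n by (simp add: par \<beta>_right)
        qed
      qed
      then show ?thesis using r by (intro exI[of _ r]) (auto simp: \<beta>_left)
    next
      case False
      then have "v \<in> U2" using v by auto
      then obtain r where r: "r < n2" "v \<in> \<beta>2 r"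
        "\<And>t. t < n2 \<Longrightarrow> v \<in> \<beta>2 t \<Longrightarrow> t \<noteq> r \<Longrightarrow> 0 < t \<and> v \<in> \<beta>2 (par2 t)"
        using top2 by blast
      have "0 < t \<and> v \<in> \<beta> (par t)" if t: "t < n1 + n2" "v \<in> \<beta> t" "t \<noteq> n1 + r" for t
      proof -
        have "\<not> t < n1" using False t(2) U1 \<beta>_left by blast
        then obtain s where s: "s < n2" "t = n1 + s" using t(1) split by blast
        then have "0 < s" "v \<in> \<beta>2 (par2 s)" using r(3)[of s] t \<beta>_right by auto
        then show ?thesis using s by (simp add: par \<beta>_right)
      qed
      then show ?thesis using r by (intro exI[of _ "n1 + r"]) (auto simp: \<beta>_right)
    qed
  qed
  ultimately show ?thesis using n unfolding tdec_def by simp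
qed

lemma rooted_tdec_glue:
  assumes "rooted_tdec k U1 D1" "rooted_tdec k U2 D2" "U1 \<inter> U2 \<subseteq> D1" "U1 \<inter> U2 \<subseteq> D2"
    and edges: "\<And>u v. u \<in> U1 \<Longrightarrow> v \<in> U2 \<Longrightarrow> E u v \<Longrightarrow> u \<in> U2 \<or> v \<in> U1"
  shows "rooted_tdec k (U1 \<union> U2) D1"
proof -
  obtain n1 par1 \<beta>1 where 1: "tdec n1 par1 \<beta>1 U1" "\<beta>1 0 = D1" "\<forall>i<n1. alpha_le (\<beta>1 i) k"
    using assms(1) unfolding rooted_tdec_def by blast
  obtain n2 par2 \<beta>2 where 2: "tdec n2 par2 \<beta>2 U2" "\<beta>2 0 = D2" "\<forall>i<n2. alpha_le (\<beta>2 i) k"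
    using assms(2) unfolding rooted_tdec_def by blast
  define par where "par = (\<lambda>i. if i < n1 then par1 i else if i = n1 then 0 else n1 + par2 (i - n1))"
  define \<beta> where "\<beta> = (\<lambda>i. if i < n1 then \<beta>1 i else \<beta>2 (i - n1))"
  have "tdec (n1 + n2) par \<beta> (U1 \<union> U2)"
    using tdec_glue[OF 1(1) 2(1) _ _ edges par_def \<beta>_def] 1(2) 2(2) assms(3,4) by simp
  moreover have "\<beta> 0 = D1" using 1 by (simp add: \<beta>_def tdec_def)
  moreover have "\<forall>i<n1 + n2. alpha_le (\<beta> i) k" using 1(3) 2(3) by (auto simp: \<beta>_def)
  ultimately show ?thesis unfolding rooted_tdec_def by blast
qed

section \<open>Components and the separator recursion\<close>

lemma reach_closed: "reach A x y \<Longrightarrow> x \<in> A \<Longrightarrow> y \<in> A"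
  unfolding reach_def by (induction rule: rtranclp_induct) auto

lemma conn_component: "conn {y. reach A x y}"
proof -
  have "reach {y. reach A x y} x y" if "reach A x y" for y
    using that[unfolded reach_def]
  proof (induction rule: rtranclp_induct)
    case (step y z)
    have "reach A x y" using step(1) by (simp add: reach_def)
    moreover have "reach A x z"
      using step(1,2) unfolding reach_def by (rule rtranclp.rtrancl_into_rtrancl)
    ultimately have "reach {y. reach A x y} y z" using step(2) by (intro reach_edge) auto
    then show ?case using step.IH by (rule reach_trans[rotated])
  qed (rule reach_refl)
  then show ?thesis
    unfolding conn_def by (blast intro: reach_trans[OF reach_sym])
qed

text \<open>The prescribed set \<open>W\<close> goes into the root bag. When \<alpha> of
  \<open>W\<close> exceeds \<open>2 * K\<close>, a balanced separator \<open>X\<close> for a maximum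
  stable set of \<open>W\<close> is added, giving at most \<open>4 * K + K\<close>. Each component
  \<open>C\<close> is then decomposed recursively with \<open>W \<inter> C\<close> and the part of
  \<open>X\<close> in \<open>U\<close> prescribed, where \<alpha> is at most
  \<open>3 * K + K\<close>.\<close>

lemma tree_decomposition_from_separators:
  assumes sep: "\<And>S. S \<subseteq> V \<Longrightarrow>
      \<exists>X\<subseteq>V. alpha_le X K \<and> (\<forall>C\<subseteq>V - X. conn C \<longrightarrow> 2 * card (S \<inter> C) \<le> card S)"
    and "1 \<le> K" and "U \<subseteq> V" "W \<subseteq> U" "alpha_le W (4 * K)"
  shows "\<exists>D. W \<subseteq> D \<and> rooted_tdec (5 * K) U D"
  using assms(3-5)
proof (induction "card U + card (U - W)" arbitrary: U W rule: less_induct)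
  case less
  have finU: "finite U" using less.prems fin_V finite_subset by blast
  then have finW: "finite W" using less.prems finite_subset by blast
  consider (all) "U = W" | (small) u where "u \<in> U - W" "alpha_le W (2 * K)" | (large) "\<not> alpha_le W (2 * K)"
    using less.prems by blast
  then show ?case
  proof cases
    case all
    then show ?thesis
      using rooted_tdec_single[of U "5 * K"] alpha_le_mono[OF less.prems(3), of "5 * K"]
      by (intro exI[of _ U]) simp
  next
    case small
    \<comment> \<open>A small \<open>W\<close> is enlarged by one vertex: \<alpha> stays below
      \<open>2 * K + 1 \<le> 4 * K\<close> or equals it, and the second summand of the measure
      drops.\<close>
    have "U - insert u W \<subset> U - W" using small by blast
    then have "card (U - insert u W) < card (U - W)"
      using finU by (intro psubset_card_mono) auto
    moreover have "alpha_le (insert u W) (4 * K)"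
      using alpha_le_insert[OF small(2)] by (rule alpha_le_mono) (use \<open>1 \<le> K\<close> in simp)
    ultimately have "\<exists>D. insert u W \<subseteq> D \<and> rooted_tdec (5 * K) U D"
      using less.prems small by (intro less.hyps) auto
    then show ?thesis by blast
  next
    case large
    obtain S where S: "S \<subseteq> W" "indep S" "alpha_le W (card S)"
      using max_indep_exists[OF finW] by blast
    have finS: "finite S" using S finW finite_subset by blast
    have big: "2 * K < card S"
      using large S(3) alpha_le_mono not_le by blast
    have S4: "card S \<le> 4 * K" using less.prems(3) S by (rule_tac alpha_leD) auto
    obtain X where X: "X \<subseteq> V" "alpha_le X K"
      and bal: "\<And>C. C \<subseteq> V - X \<Longrightarrow> conn C \<Longrightarrow> 2 * card (S \<inter> C) \<le> card S"
      using sep[of S] S less.prems by blast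
    define X' where "X' = X \<inter> U"
    define A where "A = U - X"
    define comp where "comp x = {y. reach A x y}" for x
    define D where "D = W \<union> X'"
    have X': "alpha_le X' K" using X(2) by (rule alpha_le_subset) (auto simp: X'_def)
    have comp_A: "comp x \<subseteq> A" if "x \<in> A" for x
      using that reach_closed by (auto simp: comp_def)
    have comp_eq: "comp x = comp y" if "z \<in> comp x" "z \<in> comp y" for x y z
    proof -
      have "reach A x z" "reach A y z" using that by (auto simp: comp_def)
      then have xy: "reach A x y" by (rule reach_trans[OF _ reach_sym])
      then show ?thesis
        by (auto simp: comp_def intro: reach_trans[OF xy] reach_trans[OF reach_sym[OF xy]])
    qed
    have comp_edge: "u \<in> comp x" if "v \<in> comp x" "x \<in> A" "u \<in> A" "E u v" for u v x
      using that comp_A[OF that(2)] unfolding comp_def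
      by (auto intro: reach_trans reach_edge adj_sym)
    have card_W_le: "card S \<le> card (S - C - X) + card (S \<inter> C) + K" for C
    proof -
      have "S = (S - C - X) \<union> (S \<inter> C) \<union> (S \<inter> X)" by blast
      then have "card S \<le> card (S - C - X) + card (S \<inter> C) + card (S \<inter> X)"
        by (metis add_le_mono1 card_Un_le le_trans)
      moreover have "card (S \<inter> X) \<le> K"
        using X(2) S(2) by (intro alpha_leD[of X]) (auto intro: indep_subset)
      ultimately show ?thesis by linarith
    qed
    have child: "\<exists>D'. (W \<inter> C) \<union> X' \<subseteq> D' \<and> rooted_tdec (5 * K) (C \<union> X') D'" if "x \<in> A" "C = comp x" for x C
    proof -
      have CA: "C \<subseteq> A" using comp_A that by blast
      have half: "2 * card (S \<inter> C) \<le> card S"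
        using CA less.prems conn_component that by (intro bal) (auto simp: A_def comp_def)
      \<comment> \<open>Additivity over components: \<open>T\<close> together with
        \<open>S - C - X\<close> is stable in \<open>W\<close>, so it has at most
        \<open>card S\<close> vertices. Since \<open>S - C - X\<close> has at least
        \<open>card S / 2 - K\<close> of them, at most \<open>card S / 2 + K \<le> 3 * K\<close>
        remain for \<open>T\<close>.\<close>
      have "alpha_le (W \<inter> C) (3 * K)"
        unfolding alpha_le_def
      proof (intro allI impI)
        fix T assume T: "T \<subseteq> W \<inter> C" "indep T"
        have cross: "\<not> E u v" if "u \<in> S - C - X" "v \<in> T" for u v
        proof
          assume "E u v"
          have "u \<in> A" using that S(1) less.prems unfolding A_def by blast
          moreover have "v \<in> comp x" using that T \<open>C = comp x\<close> by blast
          ultimately have "u \<in> comp x" using comp_edge \<open>x \<in> A\<close> \<open>E u v\<close> by blast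
          then show False using that \<open>C = comp x\<close> by blast
        qed
        have "indep (T \<union> (S - C - X))"
          unfolding indep_def
        proof (intro ballI)
          fix u v assume uv: "u \<in> T \<union> (S - C - X)" "v \<in> T \<union> (S - C - X)"
          consider "u \<in> T" "v \<in> T" | "u \<in> S" "v \<in> S" | "u \<in> T" "v \<in> S - C - X" | "u \<in> S - C - X" "v \<in> T"
            using uv by blast
          then show "\<not> E u v"
          proof cases
            case 3
            then show ?thesis using cross[of v u] adj_sym[of u v] by blast
          qed (use T(2) S(2) cross in \<open>auto simp: indep_def\<close>)
        qed
        then have "card (T \<union> (S - C - X)) \<le> card S"
          using T S by (intro alpha_leD[OF S(3)]) auto
        moreover have "card (T \<union> (S - C - X)) = card T + card (S - C - X)"
          using T finW finS by (intro card_Un_disjoint) (auto intro: finite_subset)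
        ultimately show "card T \<le> 3 * K"
          using card_W_le[of C] half S4 by linarith
      qed
      then have alpha: "alpha_le (W \<inter> C \<union> X') (4 * K)"
        using alpha_le_Un[OF _ X'] by fastforce
      \<comment> \<open>As \<open>card S > 2 * K\<close>, neither half of \<open>S\<close> in
        \<open>C\<close> nor the at most \<open>K\<close> vertices in \<open>X\<close> exhaust it;
        hence the child has a strictly smaller vertex set.\<close>
      have "card (S - C - X) > 0" using card_W_le[of C] half big by linarith
      then obtain s where "s \<in> S - C - X" by (metis card_gt_0_iff ex_in_conv)
      then have "C \<union> X' \<subset> U"
        using CA S less.prems by (auto simp: A_def X'_def)
      then have "card (C \<union> X') < card U" using finU by (intro psubset_card_mono) auto
      moreover have "card ((C \<union> X') - (W \<inter> C \<union> X')) \<le> card (U - W)"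
        using finU CA by (intro card_mono) (auto simp: A_def)
      ultimately show ?thesis
        using alpha CA less.prems by (intro less.hyps) (auto simp: A_def X'_def)
    qed
    \<comment> \<open>Components are glued on one at a time. A new piece meets what is already there
      only in \<open>(W \<inter> C) \<union> X'\<close>, which lies in both root bags.\<close>
    have all_sub: "rooted_tdec (5 * K) (D \<union> \<Union>F) D" if "finite F" "F \<subseteq> comp ` A" for F
      using that
    proof (induction F rule: finite_induct)
      case empty
      have "alpha_le D (4 * K + K)" unfolding D_def using less.prems(3) X' by (rule alpha_le_Un)
      then show ?case using rooted_tdec_single by simp
    next
      case (insert C F)
      then obtain x where x: "x \<in> A" "C = comp x" by auto
      obtain D' where D': "(W \<inter> C) \<union> X' \<subseteq> D'" "rooted_tdec (5 * K) (C \<union> X') D'" using child[OF x] by blast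
      have CA: "C \<subseteq> A" using comp_A x by blast
      have FA: "\<Union>F \<subseteq> A" using insert.prems comp_A by blast
      have disj: "C \<inter> \<Union>F = {}"
      proof (rule ccontr)
        assume "C \<inter> \<Union>F \<noteq> {}"
        then obtain z C' where z: "z \<in> C" "z \<in> C'" "C' \<in> F" by blast
        moreover obtain x' where "C' = comp x'" using z(3) insert.prems by blast
        ultimately have "C' = C" using x comp_eq by simp
        then show False using z(3) insert.hyps by simp
      qed
      have int: "(D \<union> \<Union>F) \<inter> (C \<union> X') \<subseteq> (W \<inter> C) \<union> X'"
        using disj FA by (auto simp: D_def A_def X'_def)
      have "rooted_tdec (5 * K) ((D \<union> \<Union>F) \<union> (C \<union> X')) D"
      proof (rule rooted_tdec_glue)
        show "rooted_tdec (5 * K) (D \<union> \<Union>F) D" using insert by simp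
        show "rooted_tdec (5 * K) (C \<union> X') D'" by (rule D')
        show "(D \<union> \<Union>F) \<inter> (C \<union> X') \<subseteq> D" using int by (auto simp: D_def)
        show "(D \<union> \<Union>F) \<inter> (C \<union> X') \<subseteq> D'" using int D' by blast
        fix u v assume u: "u \<in> D \<union> \<Union>F" and v: "v \<in> C \<union> X'" and uv: "E u v"
        have uU: "u \<in> U" using u FA less.prems by (auto simp: D_def A_def X'_def)
        show "u \<in> C \<union> X' \<or> v \<in> D \<union> \<Union>F"
        proof (cases "v \<in> C \<and> u \<in> A")
          case True
          then show ?thesis using comp_edge[of v x u] x uv by blast
        next
          case False
          then show ?thesis using v uU by (auto simp: D_def A_def X'_def)
        qed
      qed
      moreover have "(D \<union> \<Union>F) \<union> (C \<union> X') = D \<union> \<Union>(insert C F)" by (auto simp: D_def)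
      ultimately show ?case by simp
    qed
    have "x \<in> comp x" for x by (simp add: comp_def reach_refl)
    then have "D \<union> \<Union>(comp ` A) = U"
      using comp_A less.prems by (auto simp: D_def A_def X'_def)
    then have "rooted_tdec (5 * K) U D"
      using all_sub[of "comp ` A"] finU by (simp add: A_def)
    then show ?thesis by (auto simp: D_def)
  qed
qed

end

section \<open>Transfer to the library graphs\<close>

text \<open>Reduces the search for an induced copy of \<open>H\<close> to a vertex map. The inverse
  of \<open>g\<close> acts on vertices, and componentwise on arcs, as the required
  isomorphism.\<close>

lemma embedding_not_H_free:
  assumes G: "pair_graph G" and g: "g ` pverts H \<subseteq> pverts G" "inj_on g (pverts H)"
    and adj: "\<And>i j. i \<in> pverts H \<Longrightarrow> j \<in> pverts H \<Longrightarrow> (g i, g j) \<in> parcs G \<longleftrightarrow> (i, j) \<in> parcs H"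
    and H: "parcs H \<subseteq> pverts H \<times> pverts H"
  shows "\<not> H_free H G"
proof -
  interpret pair_graph G by fact
  define X where "X = g ` pverts H"
  define G' where "G' = \<lparr> pverts = X, parcs = parcs G \<inter> X \<times> X \<rparr>"
  define f where "f = the_inv_into (pverts H) g"
  have fg: "f (g i) = i" if "i \<in> pverts H" for i
    using that g(2) by (simp add: f_def the_inv_into_f_f)
  have wf: "wf_digraph (with_proj G')" by unfold_locales (auto simp: G'_def)
  have "induced_subgraph (with_proj G') (with_proj G)"
    using wf g(1) wf_digraph_axioms
    by (auto simp: induced_subgraph_def subgraph_def compatible_def G'_def X_def)
  moreover have "digraph_iso (with_proj G') (with_proj H)"
  proof -
    define h where "h = \<lparr> iso_verts = f, iso_arcs = map_prod f f, iso_head = snd, iso_tail = fst \<rparr>"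
    have injf: "inj_on f X" by (intro inj_onI) (auto simp: X_def fg)
    have "inj_on (map_prod f f) (parcs G')"
      by (rule inj_on_subset[of _ "X \<times> X"]) (auto simp: G'_def intro: map_prod_inj_on[OF injf injf])
    then have "pre_digraph.digraph_isomorphism (with_proj G') h"
      using wf injf by (auto simp: pre_digraph.digraph_isomorphism_def h_def G'_def)
    moreover have "f ` X = pverts H" by (force simp: X_def fg)
    moreover have "map_prod f f ` parcs G' = parcs H"
    proof (intro equalityI subrelI)
      fix i j assume "(i, j) \<in> map_prod f f ` parcs G'"
      then show "(i, j) \<in> parcs H" by (auto simp: G'_def X_def fg adj)
    next
      fix i j assume ij: "(i, j) \<in> parcs H"
      then have v: "i \<in> pverts H" "j \<in> pverts H" using H by auto
      then have "(g i, g j) \<in> parcs G'" using ij by (auto simp: G'_def X_def adj)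
      then have "map_prod f f (g i, g j) \<in> map_prod f f ` parcs G'" by (rule imageI)
      then show "(i, j) \<in> map_prod f f ` parcs G'" using v by (simp add: fg)
    qed
    ultimately have "with_proj H = app_iso h (with_proj G')"
      by (simp add: app_iso_def h_def with_proj_def G'_def)
    then show ?thesis
      using \<open>pre_digraph.digraph_isomorphism (with_proj G') h\<close> unfolding digraph_iso_def by blast
  qed
  ultimately show ?thesis unfolding H_free_def by blast
qed

text \<open>Passing to \<open>Suc a\<close> secures \<open>2 \<le> Suc a\<close> even for
  \<open>a = 1\<close>; a biclique with stable sides of size \<open>Suc a\<close> contains an
  induced one with sides of size \<open>a\<close>. Likewise a long induced path is cut to its first
  \<open>b\<close> vertices.\<close>

lemma pfree_of_H_free:
  assumes G: "pair_graph G" and K: "H_free (complete_bipartite a a) G" and P: "H_free (path_graph b) G"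
    and "1 \<le> a"
  shows "pfree (pverts G) (\<lambda>u v. (u, v) \<in> parcs G) (Suc a) b"
proof -
  interpret pair_graph G by fact
  interpret sgraph "pverts G" "\<lambda>u v. (u, v) \<in> parcs G"
  proof unfold_locales
    show "(v, u) \<in> parcs G" if "(u, v) \<in> parcs G" for u v
      using that pair_sym_arcs by (auto simp: symmetric_def elim: symE)
    show "(u, u) \<notin> parcs G" for u
      using pair_no_loops by force
  qed (use pair_finite_verts in_arcsD1 in_arcsD2 in auto)
  show ?thesis
  proof unfold_locales
    fix p assume p: "ipath p"
    show "length p < b"
    proof (rule ccontr)
      assume "\<not> length p < b"
      then have b: "b \<le> length p" by simp
      have "\<not> H_free (path_graph b) G"
      proof (rule embedding_not_H_free[OF G, of "nth p"])
        show "nth p ` pverts (path_graph b) \<subseteq> pverts G"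
          using b ipath_V[OF p] by (auto simp: path_graph_def)
        show "inj_on (nth p) (pverts (path_graph b))"
          using b ipath_distinct[OF p] by (auto simp: path_graph_def inj_on_def nth_eq_iff_index_eq)
        show "(p ! i, p ! j) \<in> parcs G \<longleftrightarrow> (i, j) \<in> parcs (path_graph b)"
          if "i \<in> pverts (path_graph b)" "j \<in> pverts (path_graph b)" for i j
          using that b ipath_nth_adj[OF p, of i j] by (auto simp: path_graph_def)
      qed (auto simp: path_graph_def)
      then show False using P by simp
    qed
  next
    fix A0 B0 assume A0: "A0 \<subseteq> pverts G" "B0 \<subseteq> pverts G" "indep A0" "indep B0"
      "card A0 = Suc a" "card B0 = Suc a"
    show "\<exists>x\<in>A0. \<exists>y\<in>B0. (x, y) \<notin> parcs G"
    proof (rule ccontr)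
      assume "\<not> ?thesis"
      then have all: "\<And>x y. x \<in> A0 \<Longrightarrow> y \<in> B0 \<Longrightarrow> (x, y) \<in> parcs G" by blast
      obtain A where A: "A \<subseteq> A0" "card A = a" "finite A"
        using obtain_subset_with_card_n[of a A0] A0 by auto
      obtain B where B: "B \<subseteq> B0" "card B = a" "finite B"
        using obtain_subset_with_card_n[of a B0] A0 by auto
      obtain gA where gA: "bij_betw gA {0..<a} A" using ex_bij_betw_nat_finite[OF A(3)] A(2) by auto
      obtain gB where gB: "bij_betw gB {0..<a} B" using ex_bij_betw_nat_finite[OF B(3)] B(2) by auto
      have gAi: "gA i \<in> A0" "gA i \<in> pverts G" if "i < a" for i
      proof -
        have "gA i \<in> A" using bij_betwE[OF gA] that by auto
        then show "gA i \<in> A0" "gA i \<in> pverts G" using A(1) A0(1,2) by blast+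
      qed
      have gBi: "gB i \<in> B0" "gB i \<in> pverts G" if "i < a" for i
      proof -
        have "gB i \<in> B" using bij_betwE[OF gB] that by auto
        then show "gB i \<in> B0" "gB i \<in> pverts G" using B(1) A0(1,2) by blast+
      qed
      have injA: "i = j" if "gA i = gA j" "i < a" "j < a" for i j
        using that bij_betw_imp_inj_on[OF gA] by (auto dest: inj_onD)
      have injB: "i = j" if "gB i = gB j" "i < a" "j < a" for i j
        using that bij_betw_imp_inj_on[OF gB] by (auto dest: inj_onD)
      have ne: "gA i \<noteq> gB j \<and> gB j \<noteq> gA i" if "i < a" "j < a" for i j
        using all[OF gAi(1) gBi(1)] that adj_irrefl by metis
      have AA: "(gA i, gA j) \<notin> parcs G" if "i < a" "j < a" for i j
        using A0(3) gAi(1) that by (simp add: indep_def)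
      have BB: "(gB i, gB j) \<notin> parcs G" if "i < a" "j < a" for i j
        using A0(4) gBi(1) that by (simp add: indep_def)
      have AB: "(gA i, gB j) \<in> parcs G" if "i < a" "j < a" for i j
        using all[OF gAi(1) gBi(1)] that by simp
      have BA: "(gB j, gA i) \<in> parcs G" if "i < a" "j < a" for i j
        using adj_sym[OF AB[OF that]] .
      have "\<not> H_free (complete_bipartite a a) G"
      proof (rule embedding_not_H_free[OF G, of "case_sum gA gB"])
        show "case_sum gA gB ` pverts (complete_bipartite a a) \<subseteq> pverts G"
          using gAi gBi by (auto simp: complete_bipartite_def Let_def)
        show "inj_on (case_sum gA gB) (pverts (complete_bipartite a a))"
        proof (rule inj_onI)
          fix x y
          assume "x \<in> pverts (complete_bipartite a a)" "y \<in> pverts (complete_bipartite a a)"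
            and "case_sum gA gB x = case_sum gA gB y"
          then show "x = y"
            using injA injB ne by (cases x; cases y) (auto simp: complete_bipartite_def Let_def)
        qed
        show "(case_sum gA gB i, case_sum gA gB j) \<in> parcs G \<longleftrightarrow> (i, j) \<in> parcs (complete_bipartite a a)"
          if "i \<in> pverts (complete_bipartite a a)" "j \<in> pverts (complete_bipartite a a)" for i j
          using that AA BB AB BA by (cases i; cases j) (auto simp: complete_bipartite_def Let_def)
      qed (auto simp: complete_bipartite_def Let_def)
      then show False using K by simp
    qed
  qed (use \<open>1 \<le> a\<close> in simp)
qed

section \<open>Trees given by parent functions\<close>

definition parent_tree :: "nat \<Rightarrow> (nat \<Rightarrow> nat) \<Rightarrow> nat pair_pre_digraph" where
  "parent_tree n par = \<lparr> pverts = {..<n},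
     parcs = {(i, j). i < n \<and> j < n \<and> (0 < i \<and> j = par i \<or> 0 < j \<and> i = par j)} \<rparr>"

lemma pair_graph_parent_tree:
  assumes par: "\<And>i. 0 < i \<Longrightarrow> i < n \<Longrightarrow> par i < i"
  shows "pair_graph (parent_tree n par)"
proof unfold_locales
  let ?T = "parent_tree n par"
  show "finite (parcs ?T)"
    by (rule finite_subset[of _ "{..<n} \<times> {..<n}"]) (auto simp: parent_tree_def)
  show "fst e \<noteq> snd e" if "e \<in> parcs ?T" for e
    using that par[of "fst e"] par[of "snd e"] by (auto simp: parent_tree_def)
  show "fst e \<in> pverts ?T" "snd e \<in> pverts ?T" if "e \<in> parcs ?T" for e
    using that by (auto simp: parent_tree_def)
  show "finite (pverts ?T)" by (simp add: parent_tree_def)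
  have "sym (parcs ?T)"
    by (rule symI) (simp add: parent_tree_def, blast)
  then show "symmetric (with_proj ?T)" by (simp add: symmetric_def)
qed

text \<open>Parents decrease and stay in \<open>I\<close> until \<open>r\<close> is met, so every
  node of \<open>I\<close> is joined to \<open>r\<close> inside \<open>I\<close>.\<close>

lemma connected_parent_tree_induce:
  assumes par: "\<And>i. 0 < i \<Longrightarrow> i < n \<Longrightarrow> par i < i" and I: "I \<subseteq> {..<n}" "r \<in> I"
    and top: "\<And>t. t \<in> I \<Longrightarrow> t \<noteq> r \<Longrightarrow> 0 < t \<and> par t \<in> I"
  shows "connected (with_proj (parent_tree n par) \<restriction> I)"
proof -
  define M where "M = mk_symmetric (with_proj (parent_tree n par) \<restriction> I)"
  have pM: "pverts M = I" by (simp add: M_def)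
  have arcs: "(t, par t) \<in> parcs M" "(par t, t) \<in> parcs M" if "t \<in> I" "t \<noteq> r" for t
  proof -
    have "t < n" "par t < n" "0 < t" "par t \<in> I" using top[OF that] that I by auto
    then show "(t, par t) \<in> parcs M" "(par t, t) \<in> parcs M"
      using that by (force simp: M_def parcs_mk_symmetric parent_tree_def)+
  qed
  have "t \<rightarrow>\<^sup>*\<^bsub>with_proj M\<^esub> r \<and> r \<rightarrow>\<^sup>*\<^bsub>with_proj M\<^esub> t" if "t \<in> I" for t
    using that
  proof (induction t rule: less_induct)
    case (less t)
    show ?case
    proof (cases "t = r")
      case True
      then show ?thesis using less.prems by (auto simp: reachable_def pM)
    next
      case False
      have t: "0 < t" "par t \<in> I" "t < n" using top[OF less.prems False] less.prems I by auto
      then have "par t < t" using par by simp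
      then have IH: "par t \<rightarrow>\<^sup>*\<^bsub>with_proj M\<^esub> r" "r \<rightarrow>\<^sup>*\<^bsub>with_proj M\<^esub> par t"
        using less.IH t by auto
      show ?thesis
        using IH arcs[OF less.prems False] less.prems unfolding reachable_def
        by (auto simp: pM intro: converse_rtrancl_on_into_rtrancl_on rtrancl_on_into_rtrancl_on)
    qed
  qed
  then have "u \<rightarrow>\<^sup>*\<^bsub>with_proj M\<^esub> v" if "u \<in> I" "v \<in> I" for u v
    using that unfolding reachable_def by (blast intro: rtrancl_on_trans)
  then show ?thesis
    using I unfolding connected_def strongly_connected_def M_def[symmetric] by (auto simp: pM)
qed

lemma pcas_nth:
  assumes "pcas u p v" "i < length p"
  shows "fst (p ! i) = (if i = 0 then u else snd (p ! (i - 1)))"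
  using assms by (induction u p v arbitrary: i rule: pcas.induct) (auto simp: nth_Cons split: nat.splits)

lemma pcas_last: "pcas u p v \<Longrightarrow> p \<noteq> [] \<Longrightarrow> v = snd (last p)"
  by (induction u p v rule: pcas.induct) (auto split: if_splits)

lemma tl_pawalk_verts: "tl (pawalk_verts u p) = map snd p" if "pcas u p v"
proof -
  have "pawalk_verts u p = u # map snd p" if "pcas u p v" for u
    using that by (induction u p v rule: pcas.induct) auto
  then show ?thesis using that by simp
qed

text \<open>Both neighbours on a cycle of its largest node would have to be the parent of that node.\<close>

lemma parent_tree_acyclic:
  assumes par: "\<And>i. 0 < i \<Longrightarrow> i < n \<Longrightarrow> par i < i"
    and cyc: "pre_digraph.cycle (with_proj (parent_tree n par)) p"
  shows "length p < 3"
proof (rule ccontr)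
  assume "\<not> length p < 3"
  define L where "L = length p"
  have L: "3 \<le> L" using \<open>\<not> length p < 3\<close> by (simp add: L_def)
  obtain u where "pcas u p u" "set p \<subseteq> parcs (parent_tree n par)" "distinct (tl (pawalk_verts u p))"
    using cyc
    by (auto simp: pre_digraph.cycle_def pre_digraph.awalk_def cas_with_proj_eq awalk_verts_with_proj_eq)
  then have u: "pcas u p u" "set p \<subseteq> parcs (parent_tree n par)" "distinct (map snd p)"
    by (auto simp: tl_pawalk_verts)
  \<comment> \<open>The heads of the arcs, indexed cyclically.\<close>
  define v where "v j = snd (p ! (j mod L))" for j
  have arc: "(v j, v (Suc j)) \<in> parcs (parent_tree n par)" for j
  proof -
    define i where "i = Suc j mod L"
    have i: "i < length p" using L unfolding i_def L_def by (intro mod_less_divisor) linarith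
    have "fst (p ! i) = v j"
    proof (cases "i = 0")
      case True
      then have "j mod L = L - 1"
        using L unfolding i_def by (metis mod_Suc diff_Suc_1 nat.distinct(1))
      moreover have "p \<noteq> []" using i by auto
      ultimately show ?thesis
        using pcas_nth[OF u(1) i] pcas_last[OF u(1)] True
        by (simp add: v_def L_def last_conv_nth)
    next
      case False
      then have "i - 1 = j mod L" unfolding i_def by (metis mod_Suc diff_Suc_1)
      then show ?thesis using pcas_nth[OF u(1) i] False by (simp add: v_def)
    qed
    moreover have "p ! i \<in> parcs (parent_tree n par)" using u(2) i by auto
    ultimately show ?thesis by (metis i_def prod.collapse v_def)
  qed
  have ne: "v ` {..<L} \<noteq> {}" using L by (simp add: lessThan_empty_iff)
  have "Max (v ` {..<L}) \<in> v ` {..<L}" by (rule Max_in[OF _ ne]) simp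
  then obtain k where k0: "k < L" "v k = Max (v ` {..<L})" by force
  have k: "k < L" "\<And>j. j < L \<Longrightarrow> v j \<le> v k" using k0 by auto
  have v_mod: "v (j mod L) = v j" for j by (simp add: v_def)
  have max: "v j \<le> v k" for j
    using k(2)[of "j mod L"] L v_mod by simp
  have nb: "y = par (v k)" if "(v k, y) \<in> parcs (parent_tree n par)" "y \<le> v k" for y
    using that par[of y] by (auto simp: parent_tree_def)
  have "v (Suc k) = par (v k)" using nb arc max by blast
  \<comment> \<open>\<open>k + (L - 1)\<close> is the cyclic predecessor of \<open>k\<close>,
    written so that \<open>k = 0\<close> causes no truncated subtraction.\<close>
  moreover have "v (k + (L - 1)) = par (v k)"
  proof (rule nb)
    have "v (Suc (k + (L - 1))) = v k" using L by (simp add: v_def)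
    then have "(v (k + (L - 1)), v k) \<in> parcs (parent_tree n par)" using arc[of "k + (L - 1)"] by simp
    then show "(v k, v (k + (L - 1))) \<in> parcs (parent_tree n par)" by (auto simp: parent_tree_def)
  qed (rule max)
  ultimately have eq: "snd (p ! (Suc k mod L)) = snd (p ! ((k + (L - 1)) mod L))" by (simp add: v_def)
  have inj: "x = y" if "x < length p" "y < length p" "snd (p ! x) = snd (p ! y)" for x y
    using u(3) that by (auto simp: distinct_conv_nth)
  have mod_lt: "x mod L < length p" for x
    using L unfolding L_def by (intro mod_less_divisor) linarith
  \<comment> \<open>Heads on a cycle are distinct, so the successor and the predecessor of
    \<open>k\<close> agree modulo \<open>L\<close>; this makes \<open>L\<close> divide
    \<open>L - 2\<close>, impossible for \<open>3 \<le> L\<close>.\<close>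
  have "Suc k mod L = (k + (L - 1)) mod L"
    using mod_lt mod_lt eq by (rule inj)
  moreover have "k + (L - 1) = Suc k + (L - 2)" using L by simp
  ultimately have "L dvd L - 2"
    by (metis add.commute add_diff_cancel_left' le_add1 mod_eq_dvd_iff_nat)
  then show False using L by (auto dest: dvd_imp_le)
qed

text \<open>The topmost node of a vertex serves as \<open>r\<close> in
  \<open>connected_parent_tree_induce\<close>; connectedness of the whole tree is the case
  \<open>r = 0\<close>.\<close>

lemma has_tree_alpha_bound_of_tdec:
  assumes G: "pair_graph G" and sg: "sgraph (pverts G) (\<lambda>u v. (u, v) \<in> parcs G)"
    and rooted_tdec: "sgraph.rooted_tdec (\<lambda>u v. (u, v) \<in> parcs G) k (pverts G) D"
  shows "has_tree_alpha_bound G k"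
proof -
  interpret pair_graph G by fact
  interpret sg: sgraph "pverts G" "\<lambda>u v. (u, v) \<in> parcs G" by fact
  obtain n par \<beta> where t: "sg.tdec n par \<beta> (pverts G)" and \<beta>: "\<forall>i<n. sg.alpha_le (\<beta> i) k"
    using rooted_tdec unfolding sg.rooted_tdec_def by blast
  define T where "T = parent_tree n par"
  have n: "0 < n" and par: "\<And>i. 0 < i \<Longrightarrow> i < n \<Longrightarrow> par i < i" and cov: "(\<Union>i<n. \<beta> i) = pverts G"
    and edges: "\<And>u v. u \<in> pverts G \<Longrightarrow> v \<in> pverts G \<Longrightarrow> (u, v) \<in> parcs G \<Longrightarrow> \<exists>i<n. u \<in> \<beta> i \<and> v \<in> \<beta> i"
    and top: "\<And>v. v \<in> pverts G \<Longrightarrow>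
      \<exists>r<n. v \<in> \<beta> r \<and> (\<forall>t<n. v \<in> \<beta> t \<and> t \<noteq> r \<longrightarrow> 0 < t \<and> v \<in> \<beta> (par t))"
    using t by (auto simp: sg.tdec_def)
  have pT: "pverts T = {..<n}" by (simp add: T_def parent_tree_def)
  have T: "pair_graph T" unfolding T_def using par by (rule pair_graph_parent_tree)
  have "with_proj T \<restriction> {..<n} = with_proj T"
    by (auto simp: induce_subgraph_def with_proj_def T_def parent_tree_def)
  moreover have "connected (with_proj T \<restriction> {..<n})"
    unfolding T_def
  proof (rule connected_parent_tree_induce[OF par, where r = 0])
    show "0 < t \<and> par t \<in> {..<n}" if "t \<in> {..<n}" "t \<noteq> 0" for t
      using that par[of t] by auto
  qed (use n in auto)
  ultimately have "undirected_tree T"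
    using T parent_tree_acyclic[of n par] par unfolding undirected_tree_def T_def
    by (metis not_le)
  moreover have "connected (with_proj T \<restriction> {t \<in> pverts T. v \<in> \<beta> t})" if v: "v \<in> pverts G" for v
  proof -
    obtain r where r: "r < n" "v \<in> \<beta> r"
        "\<And>t. t < n \<Longrightarrow> v \<in> \<beta> t \<Longrightarrow> t \<noteq> r \<Longrightarrow> 0 < t \<and> v \<in> \<beta> (par t)"
      using top[OF v] by blast
    show ?thesis
      unfolding T_def
    proof (rule connected_parent_tree_induce[OF par, where r = r])
      show "0 < t \<and> par t \<in> {t \<in> pverts (parent_tree n par). v \<in> \<beta> t}"
        if "t \<in> {t \<in> pverts (parent_tree n par). v \<in> \<beta> t}" "t \<noteq> r" for t
        using that r(3)[of t] par[of t] by (auto simp: parent_tree_def)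
    qed (use r in \<open>auto simp: parent_tree_def\<close>)
  qed
  ultimately have "tree_decomposition G T \<beta>"
    using cov edges in_arcsD1 in_arcsD2 unfolding tree_decomposition_def pT by fastforce
  moreover have "card S \<noteq> k + 1" if t: "t \<in> pverts T" and S: "stable_set (with_proj G \<restriction> \<beta> t) S" for t S
  proof -
    have "S \<subseteq> \<beta> t" using S by (simp add: stable_set_def)
    moreover have "(u, v) \<notin> parcs G" if "u \<in> S" "v \<in> S" for u v
    proof (cases "u = v")
      case True
      then show ?thesis using sg.adj_irrefl by simp
    next
      case False
      then have "\<not> u \<rightarrow>\<^bsub>with_proj G \<restriction> \<beta> t\<^esub> v"
        using S that by (auto simp: stable_set_def pairwise_def)
      then show ?thesis using that \<open>S \<subseteq> \<beta> t\<close> by (force simp: arcs_ends_conv)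
    qed
    ultimately have "card S \<le> k"
      using \<beta> t by (intro sg.alpha_leD[of "\<beta> t"]) (auto simp: pT sg.indep_def)
    then show ?thesis by simp
  qed
  ultimately show ?thesis unfolding has_tree_alpha_bound_def by blast
qed

lemma tree_alpha_le: "has_tree_alpha_bound G c \<Longrightarrow> 1 \<le> c \<Longrightarrow> tree_alpha G \<le> c"
  unfolding tree_alpha_def by (intro Least_le) simp

lemma bounded_tree_alpha_H_free:
  assumes "1 \<le> a"
  shows "bounded_tree_alpha {G :: 'a pair_pre_digraph.
    pair_graph G \<and> H_free (complete_bipartite a a) G \<and> H_free (path_graph b) G}"
proof -
  \<comment> \<open>Depends on \<open>a\<close> and \<open>b\<close> alone, hence is fixed before
    any graph is chosen.\<close>
  define K where "K = pfree.balanced_bound (Suc a) b"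
  have "tree_alpha G \<le> 5 * K \<and> 1 \<le> K"
    if G: "pair_graph G" and K: "H_free (complete_bipartite a a) G" and P: "H_free (path_graph b) G"
    for G :: "'a pair_pre_digraph"
  proof -
    interpret pfree "pverts G" "\<lambda>u v. (u, v) \<in> parcs G" "Suc a" b
      using pfree_of_H_free[OF G K P assms] .
    have K1: "1 \<le> K" by (simp add: K_def balanced_bound_def family_bound_def)
    have "\<exists>D. {} \<subseteq> D \<and> rooted_tdec (5 * K) (pverts G) D"
      using balanced_separator K1 unfolding K_def
      by (intro tree_decomposition_from_separators) (auto intro: alpha_le_empty)
    then have "has_tree_alpha_bound G (5 * K)"
      using has_tree_alpha_bound_of_tdec[OF G sgraph_axioms] by blast
    then show ?thesis using tree_alpha_le[of G "5 * K"] K1 by simp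
  qed
  then show ?thesis
    \<comment> \<open>The summand 1 makes the bound positive even without a member of the class,
      from which \<open>1 \<le> K\<close> is obtained above.\<close>
    unfolding bounded_tree_alpha_def by (intro exI[of _ "5 * K + 1"]) (force intro: le_SucI)
qed

theorem mainTheorem3:
  fixes a b :: nat
  assumes "a \<ge> 1" and "b \<ge> 1"
  shows "(\<forall>\<G> :: 'a pair_pre_digraph set.
            graph_class \<G> \<and> hereditary \<G> \<and>
            excludes \<G> (complete_bipartite a a) \<and> excludes \<G> (path_graph b)
            \<longrightarrow> bounded_tree_alpha \<G>)
       \<and> bounded_tree_alpha {G :: 'a pair_pre_digraph.
            pair_graph G \<and> H_free (complete_bipartite a a) G \<and> H_free (path_graph b) G}"
  (is "_ \<and> bounded_tree_alpha ?C")
proof -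
  have C: "bounded_tree_alpha ?C"
    using assms(1) by (rule bounded_tree_alpha_H_free)
  moreover have "\<G> \<subseteq> ?C"
    if "graph_class \<G>" "excludes \<G> (complete_bipartite a a)" "excludes \<G> (path_graph b)" for \<G>
    using that unfolding graph_class_def excludes_def by blast
  ultimately show ?thesis
    unfolding bounded_tree_alpha_def by blast
qed

end
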